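(* Let $X=X_\sigma$ be an affine toric variety with cone $\sigma$, let $p$ be the primitive vector on a ray $\rho$ of $\sigma$, let $e_1,e_2$ be Demazure roots of $X_\sigma$ corresponding to $p$, and endow $X$ with the monoid structure of corank one given by the comultiplication $$\chi^u\mapsto\chi^u\otimes\chi^u\,(1\otimes\chi^{e_1}+\chi^{e_2}\otimes1)^{\langle p,u\rangle},\qquad u\in S_\sigma.$$ Let $G_\chi$ be the group of invertible elements of $X$, let $E(X)$ be the closed subvariety of all idempotents of $X$, and for a face $\gamma$ of $\sigma$ let $E_\gamma=E(X)\cap O_\gamma$. Then: (a) For any face $\gamma$ of the cone $\sigma$ such that $\rho$ is not a ray of $\gamma$ and exactly one of the Demazure roots $e_1,e_2$ belongs to $\gamma^\perp$, $$\overline{E_\gamma}=E_\gamma\cup\{x_{\mathrm{cone}(\gamma,\rho)}\},$$ where the closure is taken in $X$. (b) Irreducible components of the subvariety $E(X)$ do not intersect; each of them is either a point or is isomorphic to the affine line. (c) Any irreducible component of $E(X)$ is a subset of a $(G_\chi\times G_\chi)$-orbit, and any $(G_\chi\times G_\chi)$-orbit contains at most one irreducible component of $E(X)$.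
   Context: The ground field $\mathbb K$ is algebraically closed of characteristic zero. $N$ is a lattice of rank $n$, $N_{\mathbb Q}=N\otimes_{\mathbb Z}\mathbb Q$, $M=\mathrm{Hom}(N,\mathbb Z)$, $M_{\mathbb Q}=M\otimes_{\mathbb Z}\mathbb Q$, with pairing $\langle\cdot,\cdot\rangle$. For a strongly convex polyhedral cone $\sigma\subseteq N_{\mathbb Q}$: $\sigma^\vee=\{u\in M_{\mathbb Q}\mid\langle v,u\rangle\ge0\ \forall v\in\sigma\}$, $S_\sigma=M\cap\sigma^\vee$, $X_\sigma=\mathrm{Spec}\bigoplus_{u\in S_\sigma}\mathbb K\chi^u$ with $\chi^u\chi^{u'}=\chi^{u+u'}$. A ray is a one-dimensional face. If $p_1,\dots,p_m$ are the primitive lattice vectors on the rays of $\sigma$, a Demazure root corresponding to $p_i$ is $e\in M$ with $\langle p_i,e\rangle=-1$ and $\langle p_j,e\rangle\ge0$ for $j\ne i$. The comultiplication is dual to the multiplication $(x,y)\mapsto x*y$; explicitly, $\chi^u(x*y)=\sum_{i+j=\langle p,u\rangle}\binom{\langle p,u\rangle}{i}\chi^{u+ie_2}(x)\chi^{u+je_1}(y)$. (This is an associative multiplication with unity, whose group of invertible elements has a maximal torus of codimension one.) For $\tau\subseteq N_{\mathbb Q}$, $\tau^\perp=\{u\in M_{\mathbb Q}\mid\langle v,u\rangle=0\ \forall v\in\tau\}$; $\mathrm{cone}(\gamma,\rho)$ is the cone generated by $\gamma$ and $\rho$; when $\rho$ is not a ray of $\gamma$ and some $e_k\in\gamma^\perp$,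 it is a face of $\sigma$. Points of $X_\sigma$ correspond to semigroup homomorphisms $S_\sigma\to(\mathbb K,\cdot)$ (with $0\mapsto1$), $x\mapsto(u\mapsto\chi^u(x))$. The orbits of the torus $\mathbb T=\mathrm{Hom}(M,\mathbb K^\times)$ on $X_\sigma$ are $O_\gamma$ for faces $\gamma$ of $\sigma$: $O_\gamma$ is the set of $x$ with $\chi^u(x)\ne0$ for $u\in\gamma^\perp\cap S_\sigma$ and $\chi^u(x)=0$ for $u\in S_\sigma\setminus\gamma^\perp$. The distinguished point $x_\gamma\in O_\gamma$ is given by $\chi^u(x_\gamma)=1$ if $u\in\gamma^\perp$ and $0$ otherwise. An idempotent is $x\in X$ with $x*x=x$. The group $G_\chi\times G_\chi$ acts on $X$ by left and right multiplication: $(g,h)\cdot x=g*x*h^{-1}$. *)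

theory Defs
  imports
    "HOL-Analysis.Analysis"
    "HOL-Algebra.Group_Action"
    "HOL-Library.Poly_Mapping"
    "HOL-Library.Product_Plus"
begin

section \<open>Rational polyhedral cones\<close>

text \<open>
  A basis of \<open>N\<close> is fixed throughout, together with the dual basis of \<open>M\<close>. Both lattices are then
  \<^typ>\<open>int^'n\<close>, both \<open>N\<^sub>\<rat>\<close> and \<open>M\<^sub>\<rat>\<close> are \<^typ>\<open>rat^'n\<close>, and the pairing is
  \<^const>\<open>scalar_product\<close>. The rank is the cardinality of \<open>'n\<close>.
\<close>

definition rat_vec :: "int^'n \<Rightarrow> rat^'n" where
  "rat_vec u = (\<chi> i. of_int (u $ i))"

definition cone_hull :: "(rat^'n) set \<Rightarrow> (rat^'n) set" where
  "cone_hull S = {\<Sum>v\<in>F. c v *s v | F c. finite F \<and> F \<subseteq> S \<and> (\<forall>v\<in>F. 0 \<le> c v)}"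

definition polyhedral_cone :: "(rat^'n) set \<Rightarrow> bool" where
  "polyhedral_cone \<sigma> \<longleftrightarrow> (\<exists>S. finite S \<and> \<sigma> = cone_hull S)"

definition strongly_convex :: "(rat^'n) set \<Rightarrow> bool" where
  "strongly_convex \<sigma> \<longleftrightarrow> \<sigma> \<inter> uminus ` \<sigma> = {0}"

definition dual_cone :: "(rat^'n) set \<Rightarrow> (rat^'n) set" where
  "dual_cone \<sigma> = {u. \<forall>v\<in>\<sigma>. 0 \<le> scalar_product v u}"

definition perp :: "(rat^'n) set \<Rightarrow> (rat^'n) set" where
  "perp \<tau> = {u. \<forall>v\<in>\<tau>. scalar_product v u = 0}"

definition is_face :: "(rat^'n) set \<Rightarrow> (rat^'n) set \<Rightarrow> bool" where
  "is_face \<tau> \<sigma> \<longleftrightarrow> (\<exists>u\<in>dual_cone \<sigma>. \<tau> = {v\<in>\<sigma>. scalar_product v u = 0})"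

definition is_ray :: "(rat^'n) set \<Rightarrow> (rat^'n) set \<Rightarrow> bool" where
  "is_ray \<rho> \<sigma> \<longleftrightarrow> is_face \<rho> \<sigma> \<and> vec.dim \<rho> = 1"

definition primitive_vector :: "int^'n \<Rightarrow> (rat^'n) set \<Rightarrow> bool" where
  "primitive_vector p \<rho> \<longleftrightarrow>
     p \<noteq> 0 \<and> rat_vec p \<in> \<rho> \<and> (\<forall>k q. p = k *s q \<longrightarrow> \<bar>k\<bar> = 1)"

definition demazure_root :: "(rat^'n) set \<Rightarrow> int^'n \<Rightarrow> int^'n \<Rightarrow> bool" where
  "demazure_root \<sigma> p e \<longleftrightarrow>
     scalar_product p e = -1 \<and>
     (\<forall>\<rho> q. is_ray \<rho> \<sigma> \<and> primitive_vector q \<rho> \<and> q \<noteq> p \<longrightarrow> 0 \<le> scalar_product q e)"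

definition weight_semigroup :: "(rat^'n) set \<Rightarrow> (int^'n) set" where
  "weight_semigroup \<sigma> = {u. rat_vec u \<in> dual_cone \<sigma>}"


section \<open>Affine toric varieties\<close>

text \<open>
  A point \<open>x\<close> is the semigroup homomorphism \<open>u \<mapsto> \<chi>\<^sup>u(x)\<close>, extended by
  \<^const>\<open>undefined\<close> outside the weight semigroup.
\<close>

definition toric_points :: "(rat^'n) set \<Rightarrow> (int^'n \<Rightarrow> 'k::field) set" where
  "toric_points \<sigma> =
     {x \<in> extensional (weight_semigroup \<sigma>). x 0 = 1 \<and>
        (\<forall>u\<in>weight_semigroup \<sigma>. \<forall>v\<in>weight_semigroup \<sigma>. x (u + v) = x u * x v)}"

text \<open>
  \<^term>\<open>Poly_Mapping.single u 1\<close> is the character \<open>\<chi>\<^sup>u\<close>; the product of finitely supported functions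
  is convolution, so this is the semigroup algebra of the weight semigroup.
\<close>

definition coordinate_ring :: "(rat^'n) set \<Rightarrow> ((int^'n) \<Rightarrow>\<^sub>0 'k::field) set" where
  "coordinate_ring \<sigma> = {f. Poly_Mapping.keys f \<subseteq> weight_semigroup \<sigma>}"

definition eval_at :: "('a \<Rightarrow> 'k::field) \<Rightarrow> ('a \<Rightarrow>\<^sub>0 'k) \<Rightarrow> 'k" where
  "eval_at x f = (\<Sum>u\<in>Poly_Mapping.keys f. Poly_Mapping.lookup f u * x u)"

definition zariski :: "(rat^'n) set \<Rightarrow> (int^'n \<Rightarrow> 'k::field) topology" where
  "zariski \<sigma> = topology (\<lambda>U. \<exists>F\<subseteq>coordinate_ring \<sigma>.
     U = {x \<in> toric_points \<sigma>. \<exists>f\<in>F. eval_at x f \<noteq> 0})"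

definition torus_orbit :: "(rat^'n) set \<Rightarrow> (rat^'n) set \<Rightarrow> (int^'n \<Rightarrow> 'k::field) set" where
  "torus_orbit \<sigma> \<gamma> =
     {x \<in> toric_points \<sigma>. \<forall>u\<in>weight_semigroup \<sigma>. x u \<noteq> 0 \<longleftrightarrow> rat_vec u \<in> perp \<gamma>}"

definition distinguished_point :: "(rat^'n) set \<Rightarrow> (rat^'n) set \<Rightarrow> (int^'n \<Rightarrow> 'k::field)" where
  "distinguished_point \<sigma> \<gamma> =
     (\<lambda>u\<in>weight_semigroup \<sigma>. if rat_vec u \<in> perp \<gamma> then 1 else 0)"


section \<open>The monoid structure\<close>

text \<open>
  \<open>\<bbbK>[M] \<otimes> \<bbbK>[M]\<close> is identified with \<open>\<bbbK>[M \<times> M]\<close>, the tensor \<open>\<chi>\<^sup>a \<otimes> \<chi>\<^sup>b\<close> being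
  \<open>Poly_Mapping.single (a, b) 1\<close>. The factor \<open>1 \<otimes> \<chi>\<^bsup>e1\<^esup> + \<chi>\<^bsup>e2\<^esup> \<otimes> 1\<close> is not regular on
  \<open>X \<times> X\<close>, so the product is first expanded in \<open>\<bbbK>[M \<times> M]\<close>, where all its terms
  turn out to lie in \<open>\<bbbK>[X] \<otimes> \<bbbK>[X]\<close>, and only then evaluated at a pair of points.
\<close>

definition comult :: "int^'n \<Rightarrow> int^'n \<Rightarrow> int^'n \<Rightarrow> int^'n \<Rightarrow> ((int^'n) \<times> (int^'n)) \<Rightarrow>\<^sub>0 'k::field" where
  "comult p e1 e2 u =
     Poly_Mapping.single (u, u) 1 *
     (Poly_Mapping.single (0, e1) 1 + Poly_Mapping.single (e2, 0) 1) ^ nat (scalar_product p u)"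

definition toric_mult ::
  "(rat^'n) set \<Rightarrow> int^'n \<Rightarrow> int^'n \<Rightarrow> int^'n \<Rightarrow>
   (int^'n \<Rightarrow> 'k::field) \<Rightarrow> (int^'n \<Rightarrow> 'k) \<Rightarrow> (int^'n \<Rightarrow> 'k)" where
  "toric_mult \<sigma> p e1 e2 x y =
     (\<lambda>u\<in>weight_semigroup \<sigma>. eval_at (\<lambda>(a, b). x a * y b) (comult p e1 e2 u))"

definition toric_unit ::
  "(rat^'n) set \<Rightarrow> int^'n \<Rightarrow> int^'n \<Rightarrow> int^'n \<Rightarrow> (int^'n \<Rightarrow> 'k::field)" where
  "toric_unit \<sigma> p e1 e2 =
     (THE z. z \<in> toric_points \<sigma> \<and>
        (\<forall>x\<in>toric_points \<sigma>. toric_mult \<sigma> p e1 e2 z x = x \<and> toric_mult \<sigma> p e1 e2 x z = x))"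

definition toric_monoid ::
  "(rat^'n) set \<Rightarrow> int^'n \<Rightarrow> int^'n \<Rightarrow> int^'n \<Rightarrow> (int^'n \<Rightarrow> 'k::field) monoid" where
  "toric_monoid \<sigma> p e1 e2 =
     \<lparr>carrier = toric_points \<sigma>, mult = toric_mult \<sigma> p e1 e2, one = toric_unit \<sigma> p e1 e2\<rparr>"

definition idempotents :: "('a, 'b) monoid_scheme \<Rightarrow> 'a set" where
  "idempotents G = {x \<in> carrier G. x \<otimes>\<^bsub>G\<^esub> x = x}"

definition two_sided_orbits :: "('a, 'b) monoid_scheme \<Rightarrow> 'a set set" where
  "two_sided_orbits G =
     orbits (units_of G \<times>\<times> units_of G) (carrier G) (\<lambda>(g, h) x. g \<otimes>\<^bsub>G\<^esub> x \<otimes>\<^bsub>G\<^esub> inv\<^bsub>G\<^esub> h)"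


section \<open>Irreducible components and isomorphisms of affine varieties\<close>

definition irreducible_in :: "'a topology \<Rightarrow> 'a set \<Rightarrow> bool" where
  "irreducible_in T S \<longleftrightarrow> S \<subseteq> topspace T \<and> S \<noteq> {} \<and>
     (\<forall>A B. closedin T A \<and> closedin T B \<and> S \<subseteq> A \<union> B \<longrightarrow> S \<subseteq> A \<or> S \<subseteq> B)"

definition irreducible_components :: "'a topology \<Rightarrow> 'a set set" where
  "irreducible_components T =
     {C. irreducible_in T C \<and> (\<forall>D. irreducible_in T D \<and> C \<subseteq> D \<longrightarrow> D = C)}"

text \<open>
  An affine variety is represented by its set of points and its algebra of regular functions; a
  morphism is a map of points that pulls regular functions back to regular functions.
\<close>

type_synonym ('a, 'k) variety = "'a set \<times> ('a \<Rightarrow> 'k) set"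

definition variety_morphism :: "('a, 'k) variety \<Rightarrow> ('b, 'k) variety \<Rightarrow> ('a \<Rightarrow> 'b) \<Rightarrow> bool" where
  "variety_morphism V W \<phi> \<longleftrightarrow>
     \<phi> \<in> fst V \<rightarrow> fst W \<and> (\<forall>f\<in>snd W. restrict (f \<circ> \<phi>) (fst V) \<in> snd V)"

definition variety_isomorphic :: "('a, 'k) variety \<Rightarrow> ('b, 'k) variety \<Rightarrow> bool" where
  "variety_isomorphic V W \<longleftrightarrow>
     (\<exists>\<phi> \<psi>. variety_morphism V W \<phi> \<and> variety_morphism W V \<psi> \<and>
        (\<forall>x\<in>fst V. \<psi> (\<phi> x) = x) \<and> (\<forall>y\<in>fst W. \<phi> (\<psi> y) = y))"

definition subvariety :: "(rat^'n) set \<Rightarrow> (int^'n \<Rightarrow> 'k::field) set \<Rightarrow> (int^'n \<Rightarrow> 'k, 'k) variety" where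
  "subvariety \<sigma> C = (C, (\<lambda>f. \<lambda>x\<in>C. eval_at x f) ` coordinate_ring \<sigma>)"

definition affine_line :: "('k::field, 'k) variety" where
  "affine_line = (UNIV, range poly)"


section \<open>Adequacy of the definitions\<close>

text \<open>
  The sets in the definition of \<^const>\<open>zariski\<close> do form a topology, its closed sets are the zero
  sets of families of regular functions, and evaluating \<^const>\<open>comult\<close> yields the binomial sum for
  \<open>\<chi>\<^sup>u(x * y)\<close>.
\<close>

lemma eval_at_superset:
  assumes "finite A" "Poly_Mapping.keys f \<subseteq> A"
  shows "eval_at x f = (\<Sum>u\<in>A. Poly_Mapping.lookup f u * x u)"
  unfolding eval_at_def
  by (rule sum.mono_neutral_left) (use assms in \<open>auto simp: in_keys_iff\<close>)

lemma eval_at_zero [simp]: "eval_at x 0 = 0"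
  by (simp add: eval_at_def)

lemma eval_at_single [simp]: "eval_at x (Poly_Mapping.single u c) = c * x u"
  by (simp add: eval_at_def)

lemma eval_at_one [simp]: "eval_at x 1 = x 0"
  using eval_at_single[of x 0 1] by simp

lemma eval_at_add: "eval_at x (f + g) = eval_at x f + eval_at x g"
proof -
  let ?A = "Poly_Mapping.keys f \<union> Poly_Mapping.keys g"
  have *: "eval_at x h = (\<Sum>u\<in>?A. Poly_Mapping.lookup h u * x u)" if "Poly_Mapping.keys h \<subseteq> ?A" for h
    by (rule eval_at_superset) (use that in auto)
  show ?thesis
    by (subst (1 2 3) *) (use keys_add[of f g] in \<open>auto simp: lookup_add algebra_simps sum.distrib\<close>)
qed

lemma eval_at_sum: "eval_at x (sum f A) = (\<Sum>a\<in>A. eval_at x (f a))"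
  by (induction A rule: infinite_finite_induct) (simp_all add: eval_at_add)

lemma eval_at_mult:
  assumes mult: "\<And>u v. u \<in> S \<Longrightarrow> v \<in> S \<Longrightarrow> x (u + v) = x u * x v"
    and "Poly_Mapping.keys f \<subseteq> S" "Poly_Mapping.keys g \<subseteq> S"
  shows "eval_at x (f * g) = eval_at x f * eval_at x g"
proof -
  have dec: "h = (\<Sum>u\<in>Poly_Mapping.keys h. Poly_Mapping.single u (Poly_Mapping.lookup h u))"
    for h :: "'a \<Rightarrow>\<^sub>0 'b"
    by (rule poly_mapping_eqI) (auto simp: lookup_sum lookup_single when_def in_keys_iff)
  have "f * g = (\<Sum>u\<in>Poly_Mapping.keys f. \<Sum>v\<in>Poly_Mapping.keys g.
      Poly_Mapping.single (u + v) (Poly_Mapping.lookup f u * Poly_Mapping.lookup g v))"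
    by (rule trans[OF arg_cong2[OF dec[of f] dec[of g], of "(*)"]]) (simp only: sum_product mult_single)
  also have "eval_at x \<dots> = (\<Sum>u\<in>Poly_Mapping.keys f. \<Sum>v\<in>Poly_Mapping.keys g.
      Poly_Mapping.lookup f u * Poly_Mapping.lookup g v * x (u + v))"
    by (simp add: eval_at_sum)
  also have "\<dots> = eval_at x f * eval_at x g"
    unfolding eval_at_def sum_product
    by (intro sum.cong refl) (use assms in \<open>auto simp: subset_iff\<close>)
  finally show ?thesis .
qed

lemma rat_vec_add: "rat_vec (u + v) = rat_vec u + rat_vec v"
  by (simp add: rat_vec_def vec_eq_iff)

lemma scalar_product_add_right: "scalar_product v (a + b) = scalar_product v a + scalar_product v b"
  by (simp add: scalar_product_def algebra_simps sum.distrib)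

lemma weight_semigroup_add:
  "u \<in> weight_semigroup \<sigma> \<Longrightarrow> v \<in> weight_semigroup \<sigma> \<Longrightarrow> u + v \<in> weight_semigroup \<sigma>"
  by (simp add: weight_semigroup_def dual_cone_def rat_vec_add scalar_product_add_right)

lemma weight_semigroup_0: "0 \<in> weight_semigroup \<sigma>"
  by (simp add: weight_semigroup_def dual_cone_def rat_vec_def scalar_product_def)

lemma eval_at_mult_points:
  assumes "x \<in> toric_points \<sigma>" "f \<in> coordinate_ring \<sigma>" "g \<in> coordinate_ring \<sigma>"
  shows "eval_at x (f * g) = eval_at x f * eval_at x g"
  by (rule eval_at_mult[where S = "weight_semigroup \<sigma>"])
     (use assms in \<open>auto simp: toric_points_def coordinate_ring_def\<close>)

lemma coordinate_ring_mult:
  assumes "f \<in> coordinate_ring \<sigma>" "g \<in> coordinate_ring \<sigma>"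
  shows "f * g \<in> coordinate_ring \<sigma>"
  using assms keys_mult[of f g] weight_semigroup_add
  by (fastforce simp: coordinate_ring_def)

lemma istopology_zariski:
  "istopology (\<lambda>U. \<exists>F\<subseteq>coordinate_ring \<sigma>.
     U = {x \<in> toric_points \<sigma> :: (int^'n \<Rightarrow> 'k::field) set. \<exists>f\<in>F. eval_at x f \<noteq> 0})"
  unfolding istopology_def
proof (intro conjI allI impI)
  let ?D = "\<lambda>F. {x \<in> toric_points \<sigma> :: (int^'n \<Rightarrow> 'k::field) set. \<exists>f\<in>F. eval_at x f \<noteq> 0}"
  fix U V assume "\<exists>F\<subseteq>coordinate_ring \<sigma>. U = ?D F" "\<exists>F\<subseteq>coordinate_ring \<sigma>. V = ?D F"
  then obtain F G where F: "F \<subseteq> coordinate_ring \<sigma>" "U = ?D F" and G: "G \<subseteq> coordinate_ring \<sigma>" "V = ?D G"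
    by blast
  let ?H = "(\<lambda>(f, g). f * g) ` (F \<times> G)"
  have "?H \<subseteq> coordinate_ring \<sigma>"
    using F(1) G(1) by (auto intro!: coordinate_ring_mult)
  moreover have "U \<inter> V = ?D ?H"
  proof -
    have *: "eval_at x (f * g) \<noteq> 0 \<longleftrightarrow> eval_at x f \<noteq> 0 \<and> eval_at x g \<noteq> 0"
      if "x \<in> toric_points \<sigma>" "f \<in> F" "g \<in> G" for x :: "int^'n \<Rightarrow> 'k" and f g
      using eval_at_mult_points[OF that(1) subsetD[OF F(1) that(2)] subsetD[OF G(1) that(3)]] by simp
    have "(\<exists>h\<in>?H. eval_at x h \<noteq> 0) \<longleftrightarrow> (\<exists>f\<in>F. eval_at x f \<noteq> 0) \<and> (\<exists>g\<in>G. eval_at x g \<noteq> 0)"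
      if "x \<in> toric_points \<sigma>" for x :: "int^'n \<Rightarrow> 'k"
    proof -
      have "(\<exists>h\<in>?H. eval_at x h \<noteq> 0) \<longleftrightarrow> (\<exists>f\<in>F. \<exists>g\<in>G. eval_at x (f * g) \<noteq> 0)"
        by simp
      also have "\<dots> \<longleftrightarrow> (\<exists>f\<in>F. \<exists>g\<in>G. eval_at x f \<noteq> 0 \<and> eval_at x g \<noteq> 0)"
        by (intro bex_cong refl *[OF that])
      finally show ?thesis by blast
    qed
    then show ?thesis
      unfolding F(2) G(2) Int_def by (intro Collect_cong) (simp, blast)
  qed
  ultimately show "\<exists>F\<subseteq>coordinate_ring \<sigma>. U \<inter> V = ?D F" by blast
next
  let ?D = "\<lambda>F. {x \<in> toric_points \<sigma> :: (int^'n \<Rightarrow> 'k::field) set. \<exists>f\<in>F. eval_at x f \<noteq> 0}"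
  fix \<U> assume "\<forall>U\<in>\<U>. \<exists>F\<subseteq>coordinate_ring \<sigma>. U = ?D F"
  then have "\<exists>F. \<forall>U\<in>\<U>. F U \<subseteq> coordinate_ring \<sigma> \<and> U = ?D (F U)"
    by (rule bchoice)
  then obtain F where F: "\<forall>U\<in>\<U>. F U \<subseteq> coordinate_ring \<sigma> \<and> U = ?D (F U)" ..
  have "\<Union>\<U> = (\<Union>U\<in>\<U>. ?D (F U))"
    using F SUP_cong[OF refl, of \<U> "\<lambda>U. U" "\<lambda>U. ?D (F U)"] by simp
  also have "\<dots> = ?D (\<Union>U\<in>\<U>. F U)" by blast
  finally have "\<Union>\<U> = ?D (\<Union>U\<in>\<U>. F U)" .
  moreover have "(\<Union>U\<in>\<U>. F U) \<subseteq> coordinate_ring \<sigma>" using F by blast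
  ultimately show "\<exists>F\<subseteq>coordinate_ring \<sigma>. \<Union>\<U> = ?D F" by blast
qed

lemma openin_zariski:
  "openin (zariski \<sigma> :: (int^'n \<Rightarrow> 'k::field) topology) U \<longleftrightarrow>
     (\<exists>F\<subseteq>coordinate_ring \<sigma>. U = {x \<in> toric_points \<sigma>. \<exists>f\<in>F. eval_at x f \<noteq> 0})"
  unfolding zariski_def topology_inverse'[OF istopology_zariski] ..

lemma topspace_zariski: "topspace (zariski \<sigma> :: (int^'n \<Rightarrow> 'k::field) topology) = toric_points \<sigma>"
proof -
  have "openin (zariski \<sigma>) (toric_points \<sigma> :: (int^'n \<Rightarrow> 'k::field) set)"
    unfolding openin_zariski
    by (rule exI[of _ "{Poly_Mapping.single 0 1}"])
       (auto simp: coordinate_ring_def weight_semigroup_0 toric_points_def)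
  moreover have "U \<subseteq> toric_points \<sigma>" if "openin (zariski \<sigma>) U" for U :: "(int^'n \<Rightarrow> 'k::field) set"
    using that unfolding openin_zariski by auto
  ultimately show ?thesis unfolding topspace_def by blast
qed

lemma closedin_zariski:
  "closedin (zariski \<sigma> :: (int^'n \<Rightarrow> 'k::field) topology) A \<longleftrightarrow>
     (\<exists>F\<subseteq>coordinate_ring \<sigma>. A = {x \<in> toric_points \<sigma>. \<forall>f\<in>F. eval_at x f = 0})"
proof -
  have "A \<subseteq> toric_points \<sigma> \<and> toric_points \<sigma> - A = {x \<in> toric_points \<sigma>. \<exists>f\<in>F. eval_at x f \<noteq> 0}
     \<longleftrightarrow> A = {x \<in> toric_points \<sigma>. \<forall>f\<in>F. eval_at x f = 0}" for F
    by auto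
  then show ?thesis
    unfolding closedin_def openin_zariski topspace_zariski
    by (simp only: bex_simps(2)[symmetric] ex_simps(2)[symmetric] conj_left_commute[of "A \<subseteq> toric_points \<sigma>"])
qed

lemma single_one_power:
  "Poly_Mapping.single (a :: 'a::comm_monoid_add) (1::'k::field) ^ i =
     Poly_Mapping.single (((+) a ^^ i) 0) 1"
  by (induction i) (simp_all add: mult_single single_one)

lemma eval_at_comult:
  fixes x y :: "int^'n \<Rightarrow> 'k::field" and p u :: "int^'n"
  defines "d \<equiv> nat (scalar_product p u)"
  shows "eval_at (\<lambda>(a, b). x a * y b) (comult p e1 e2 u) =
    (\<Sum>i\<le>d. of_nat (d choose i) * x (u + of_nat i *s e2) * y (u + of_nat (d - i) *s e1))"
proof -
  have pow: "((+) a ^^ i) 0 = (of_nat i *s fst a, of_nat i *s snd a)" for i and a :: "(int^'n) \<times> (int^'n)"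
    by (induction i) (auto simp: prod_eq_iff vec_eq_iff algebra_simps)
  have "comult p e1 e2 u = (\<Sum>i\<le>d. Poly_Mapping.single
     (u + of_nat i *s e2, u + of_nat (d - i) *s e1) (of_nat (d choose i) :: 'k))"
    unfolding comult_def d_def[symmetric]
    by (subst add.commute, subst binomial_ring)
       (auto simp: sum_distrib_left single_one_power pow mult_single
             simp flip: single_of_nat intro!: sum.cong)
  then show ?thesis
    by (simp add: eval_at_sum mult.assoc)
qed

end

theory Submission
  imports Defs
begin

text \<open>
  Write \<open>S\<close> for the weight semigroup and call \<open>\<langle>p, u\<rangle>\<close> the height of a weight \<open>u \<in> S\<close>. Both roots have
  height \<open>-1\<close>. The algebra of the monoid rests on one consequence of the geometry of the cone: \<open>u + e \<in> S\<close> for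
  a root \<open>e\<close> and \<open>u \<in> S\<close> of positive height. This holds because a rational strongly convex cone is
  generated by its rays: on a ray other than \<open>\<rho>\<close> the root \<open>e\<close> is nonnegative, and on \<open>\<rho>\<close> the height of
  \<open>u\<close> pays for the \<open>-1\<close>. That the elements
  of a minimal generating set span rays is deduced from the theorem of Gordan on positive functionals.

  A point is a homomorphism \<open>x\<close> from \<open>S\<close> to the field, and the set \<open>F\<close> where it does not vanish is a face
  of \<open>S\<close>. For \<open>u\<close> of height \<open>h\<close>, multiplicativity turns the square into
  \<open>(x * x)(u) = x(u) \<cdot> (\<Sum>i\<le>h. (h choose i) \<cdot> x(u + i e\<^sub>2 + (h - i) e\<^sub>1))\<close>,
  where all the arguments in the sum have height 0. On weights of height 0 an idempotent takes the
  values 0 and 1, so for \<open>u \<in> F\<close> of positive height the sum counts binomial coefficients, and which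
  terms survive depends only on whether \<open>e\<^sub>1\<close> and \<open>e\<^sub>2\<close> lie in the group generated by \<open>F\<close>: it is
  \<open>2\<^sup>h\<close> if both do, 0 if none does, and 1 if exactly one does. In characteristic 0 an idempotent
  therefore needs all of \<open>F\<close> at height 0, or exactly one root in the group of \<open>F\<close>. If \<open>e\<close> is this root,
  then \<open>x(u + h e) = 1\<close> forces \<open>x(u) = t\<^sup>h\<close> on \<open>F\<close> for a single \<open>t \<noteq> 0\<close>, and
  conversely every \<open>t\<close> gives an idempotent. With \<open>0\<^sup>0 = 1\<close>, the value \<open>t = 0\<close> gives the indicator of the
  weights of height 0 in \<open>F\<close>, which is the distinguished point of the limit face. So in the
  second case the idempotents with support \<open>F\<close> form a punctured line, closed up by one point, and part (a) is the case
  \<open>F = S \<inter> \<gamma>\<^sup>\<bottom>\<close>.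

  The semigroup has finitely many faces, so the idempotents are a finite union of closed irreducible
  lines and points, and each component is one of these. If two of them meet,
  their faces have the same weights of height 0. Among the faces with exactly one root in their group,
  these weights determine the face, while a face at height 0 gives a single point. So one of the two sets contains
  the other, and distinct components are disjoint.

  On weights of height 0 the product is pointwise and invertible elements do not vanish there. Hence the
  support at height 0 is an invariant of the orbit, and two components in one orbit share the point
  with \<open>t = 0\<close>. Finally \<open>g\<^sub>s(u) = s\<^sup>h\<close> on all of \<open>S\<close> defines an additive one-parameter group
  of invertible elements, and multiplication by \<open>g\<^sub>s\<close>, on the left or on the right according to the root in
  the group of \<open>F\<close>, translates the line of \<open>F\<close> by \<open>s\<close>; so each line lies in one orbit.
\<close>

section \<open>The pairing and the Gordan alternative\<close>

lemma scalar_product_scale_right: "scalar_product v (c *s u) = c * scalar_product v (u :: 'a::comm_semiring_1^'n)"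
  by (simp add: scalar_product_def sum_distrib_left algebra_simps)

lemma scalar_product_scale_left: "scalar_product (c *s v) u = c * scalar_product v (u :: 'a::comm_semiring_1^'n)"
  by (simp add: scalar_product_def sum_distrib_left algebra_simps)

lemma scalar_product_sum_left:
  "scalar_product (sum f A) u = (\<Sum>a\<in>A. scalar_product (f a) (u :: 'a::comm_semiring_1^'n))"
  unfolding scalar_product_def sum_component sum_distrib_right by (rule sum.swap)

lemma scalar_product_add_left:
  "scalar_product (v + w) u = scalar_product v u + scalar_product w (u :: 'a::semiring_1^'n)"
  by (simp add: scalar_product_def algebra_simps sum.distrib)

lemma scalar_product_diff_left:
  "scalar_product (v - w) u = scalar_product v u - scalar_product w (u :: 'a::comm_ring_1^'n)"
  by (simp add: scalar_product_def algebra_simps sum_subtractf)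

lemma scalar_product_diff_right:
  "scalar_product u (v - w) = scalar_product u v - scalar_product u (w :: 'a::comm_ring_1^'n)"
  by (simp add: scalar_product_def algebra_simps sum_subtractf)

lemma scalar_product_axis: "scalar_product v (axis k c) = v $ k * (c :: 'a::comm_semiring_1)"
  by (simp add: scalar_product_def axis_def if_distrib cong: if_cong)

lemma scalar_product_self_pos: "v \<noteq> 0 \<Longrightarrow> 0 < scalar_product v (v :: rat^'n)"
proof -
  assume "v \<noteq> 0"
  then obtain k where "v $ k \<noteq> 0" by (auto simp: vec_eq_iff)
  then show ?thesis
    unfolding scalar_product_def by (intro sum_pos2[of _ k]) (auto simp: zero_less_mult_iff)
qed

definition positive_functional :: "'i set \<Rightarrow> ('i \<Rightarrow> rat^'n) \<Rightarrow> rat^'n \<Rightarrow> bool" where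
  "positive_functional I a u \<longleftrightarrow> (\<forall>i\<in>I. 0 < scalar_product (a i) u)"

definition nonneg_nonzero :: "'i set \<Rightarrow> ('i \<Rightarrow> rat) \<Rightarrow> bool" where
  "nonneg_nonzero I c \<longleftrightarrow> (\<forall>i\<in>I. 0 \<le> c i) \<and> (\<exists>i\<in>I. c i \<noteq> 0)"

text \<open>
  Project along \<open>v\<close> to the hyperplane where coordinate \<open>k\<close> vanishes, and apply the alternative there.
  A functional on the hyperplane extends uniquely to one that kills \<open>v\<close>, and a relation between the
  projections is a relation modulo multiples of \<open>v\<close>.
\<close>
lemma gordan_modulo_vector:
  fixes a :: "'i \<Rightarrow> rat^'n"
  assumes gordan: "\<And>b :: 'i \<Rightarrow> rat^'n. (\<exists>u. positive_functional I b u) \<or>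
      (\<exists>c. nonneg_nonzero I c \<and> (\<Sum>i\<in>I. c i *s b i) = 0)"
    and "v \<noteq> 0"
  shows "(\<exists>u. scalar_product v u = 0 \<and> positive_functional I a u) \<or>
      (\<exists>c l. nonneg_nonzero I c \<and> (\<Sum>i\<in>I. c i *s a i) = l *s v)"
proof -
  obtain k where k: "v $ k \<noteq> 0" using \<open>v \<noteq> 0\<close> by (auto simp: vec_eq_iff)
  define b where "b i = a i - (a i $ k / v $ k) *s v" for i
  show ?thesis
    using gordan[of b]
  proof (elim disjE exE conjE)
    fix u assume u: "positive_functional I b u"
    define u' where "u' = u - axis k (scalar_product v u / v $ k)"
    have "scalar_product v u' = 0"
      using k by (simp add: u'_def scalar_product_diff_right scalar_product_axis)
    moreover have "scalar_product (a i) u' = scalar_product (b i) u" for i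
      by (simp add: u'_def b_def scalar_product_diff_right scalar_product_diff_left
          scalar_product_axis scalar_product_scale_left)
    ultimately show ?thesis using u by (auto simp: positive_functional_def)
  next
    fix c assume c: "nonneg_nonzero I c" "(\<Sum>i\<in>I. c i *s b i) = 0"
    have "(\<Sum>i\<in>I. c i *s a i) - (\<Sum>i\<in>I. c i * (a i $ k / v $ k)) *s v = (\<Sum>i\<in>I. c i *s b i)"
      by (simp add: b_def vec_eq_iff sum_component sum_distrib_left algebra_simps sum_subtractf)
    then show ?thesis using c by auto
  qed
qed

text \<open>
  The alternative is proved by induction on the number of vectors, through its version modulo the new
  vector \<open>v\<close>. A functional that kills \<open>v\<close> and is positive on the old vectors becomes positive on all
  after adding a small multiple of \<open>v\<close> itself. Otherwise some nonnegative combination of the old vectors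
  is \<open>l\<close> times \<open>v\<close>: for \<open>l \<le> 0\<close> this is a relation, and for \<open>l > 0\<close> a functional that is
  positive on the old vectors is positive on \<open>v\<close>.
\<close>
lemma gordan:
  fixes a :: "'i \<Rightarrow> rat^'n"
  assumes "finite I"
  shows "(\<exists>u. positive_functional I a u) \<or> (\<exists>c. nonneg_nonzero I c \<and> (\<Sum>i\<in>I. c i *s a i) = 0)"
  using assms
proof (induction I arbitrary: a rule: finite_induct)
  case empty
  then show ?case by (simp add: positive_functional_def)
next
  case (insert j I a)
  let ?goal = "\<exists>c. nonneg_nonzero (insert j I) c \<and> (\<Sum>i\<in>insert j I. c i *s a i) = 0"
  have relation: ?goal if "nonneg_nonzero I c \<or> l \<noteq> 0" "\<forall>i\<in>I. 0 \<le> c i" "0 \<le> l"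
      "(\<Sum>i\<in>I. c i *s a i) + l *s a j = 0" for c l
  proof (intro exI conjI)
    let ?c = "c(j := l)"
    have "(\<Sum>i\<in>I. ?c i *s a i) = (\<Sum>i\<in>I. c i *s a i)"
      using insert.hyps by (intro sum.cong) auto
    then show "(\<Sum>i\<in>insert j I. ?c i *s a i) = 0"
      using insert.hyps that(4) by (simp add: add.commute)
    show "nonneg_nonzero (insert j I) ?c"
      using insert.hyps that(1-3) by (auto simp: nonneg_nonzero_def)
  qed
  show ?case
  proof (cases "a j = 0")
    case True
    then show ?thesis using relation[of "\<lambda>_. 0" 1] by simp
  next
    case False
    from gordan_modulo_vector[OF insert.IH False, of a] show ?thesis
    proof (elim disjE exE conjE)
      fix u assume u: "scalar_product (a j) u = 0" "positive_functional I a u"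
      \<comment> \<open>Small enough that \<open>m\<close> times the pairing with \<open>a j\<close> cannot cancel the positive value of \<open>u\<close>.\<close>
      define m where "m = Min (insert 1 ((\<lambda>i. scalar_product (a i) u / (1 + \<bar>scalar_product (a i) (a j)\<bar>)) ` I))"
      have m: "0 < m" "\<And>i. i \<in> I \<Longrightarrow> m \<le> scalar_product (a i) u / (1 + \<bar>scalar_product (a i) (a j)\<bar>)"
        using insert.hyps u by (auto simp: m_def positive_functional_def Min_gr_iff add_pos_nonneg)
      have "0 < scalar_product (a i) (u + m *s a j)" if "i \<in> I" for i
      proof -
        let ?s = "scalar_product (a i) (a j)"
        have "m * (1 + \<bar>?s\<bar>) \<le> scalar_product (a i) u"
          using m(2)[OF that] by (simp add: pos_le_divide_eq add_pos_nonneg)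
        moreover have "m * (1 + \<bar>?s\<bar>) + m * ?s > 0"
        proof -
          have "m * (1 + \<bar>?s\<bar> + ?s) > 0" using m(1) by (intro mult_pos_pos) auto
          then show ?thesis by (simp add: algebra_simps)
        qed
        ultimately show ?thesis
          by (simp add: scalar_product_add_right scalar_product_scale_right)
      qed
      moreover have "0 < scalar_product (a j) (u + m *s a j)"
        using u(1) m(1) scalar_product_self_pos[OF False]
        by (simp add: scalar_product_add_right scalar_product_scale_right)
      ultimately show ?thesis by (auto simp: positive_functional_def)
    next
      fix c l assume c: "nonneg_nonzero I c" "(\<Sum>i\<in>I. c i *s a i) = l *s a j"
      show ?thesis
      proof (cases "l \<le> 0")
        case True
        then show ?thesis
          using c relation[of c "- l"] by (auto simp: nonneg_nonzero_def)
      next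
        case False
        from insert.IH[of a] show ?thesis
        proof (elim disjE exE conjE)
          fix u assume u: "positive_functional I a u"
          have "0 < (\<Sum>i\<in>I. c i * scalar_product (a i) u)"
            using c(1) u insert.hyps
            by (auto simp: nonneg_nonzero_def positive_functional_def le_less intro!: sum_pos2)
          also have "\<dots> = l * scalar_product (a j) u"
            using arg_cong[OF c(2), of "\<lambda>v. scalar_product v u"]
            by (simp add: scalar_product_sum_left scalar_product_scale_left)
          finally show ?thesis
            using False u by (auto simp: positive_functional_def zero_less_mult_iff)
        next
          fix c assume "nonneg_nonzero I c" "(\<Sum>i\<in>I. c i *s a i) = 0"
          then show ?thesis using relation[of c 0] by (auto simp: nonneg_nonzero_def)
        qed
      qed
    qed
  qed
qed

section \<open>Generators and rays of rational cones\<close>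

lemma cone_hull_finite:
  assumes "finite A"
  shows "x \<in> cone_hull A \<longleftrightarrow> (\<exists>c. (\<forall>v\<in>A. 0 \<le> c v) \<and> x = (\<Sum>v\<in>A. c v *s v))"
proof
  assume "x \<in> cone_hull A"
  then obtain F c where F: "F \<subseteq> A" "\<forall>v\<in>F. 0 \<le> c v" "x = (\<Sum>v\<in>F. c v *s v)"
    unfolding cone_hull_def by blast
  have "(\<Sum>v\<in>F. c v *s v) = (\<Sum>v\<in>A. (if v \<in> F then c v else 0) *s v)"
    using F(1) assms by (intro sum.mono_neutral_cong_left) auto
  then show "\<exists>c. (\<forall>v\<in>A. 0 \<le> c v) \<and> x = (\<Sum>v\<in>A. c v *s v)"
    using F(2,3) by (intro exI[of _ "\<lambda>v. if v \<in> F then c v else 0"]) auto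
next
  show "\<exists>c. (\<forall>v\<in>A. 0 \<le> c v) \<and> x = (\<Sum>v\<in>A. c v *s v) \<Longrightarrow> x \<in> cone_hull A"
    unfolding cone_hull_def using assms by blast
qed

lemma cone_hull_singleton: "cone_hull {v} = {c *s v | c. 0 \<le> c}"
  by (auto simp: cone_hull_finite)

lemma subset_cone_hull: "S \<subseteq> cone_hull S"
proof
  fix v assume "v \<in> S"
  then show "v \<in> cone_hull S"
    unfolding cone_hull_def by (intro CollectI exI[of _ "{v}"] exI[of _ "\<lambda>_. 1"]) auto
qed

lemma perp_cone_hull: "perp (cone_hull S) = perp S"
proof
  show "perp (cone_hull S) \<subseteq> perp S"
    using subset_cone_hull by (auto simp: perp_def)
  show "perp S \<subseteq> perp (cone_hull S)"
    by (auto simp: perp_def cone_hull_def scalar_product_sum_left scalar_product_scale_left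
        subset_iff intro!: sum.neutral)
qed

lemma dual_cone_hull: "dual_cone (cone_hull S) = dual_cone S"
proof
  show "dual_cone (cone_hull S) \<subseteq> dual_cone S"
    using subset_cone_hull by (auto simp: dual_cone_def)
  show "dual_cone S \<subseteq> dual_cone (cone_hull S)"
    by (auto simp: dual_cone_def cone_hull_def scalar_product_sum_left scalar_product_scale_left
        subset_iff intro!: sum_nonneg)
qed

lemma minimal_generators:
  assumes "polyhedral_cone \<sigma>"
  obtains A where "finite A" "\<sigma> = cone_hull A" "\<And>v. v \<in> A \<Longrightarrow> v \<notin> cone_hull (A - {v})"
proof -
  obtain A where A: "finite A" "\<sigma> = cone_hull A"
    and min: "\<And>B. finite B \<Longrightarrow> \<sigma> = cone_hull B \<Longrightarrow> card A \<le> card B"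
    using assms ex_has_least_nat[of "\<lambda>A. finite A \<and> \<sigma> = cone_hull A" _ card]
    unfolding polyhedral_cone_def by metis
  have "v \<notin> cone_hull (A - {v})" if "v \<in> A" for v
  proof
    assume "v \<in> cone_hull (A - {v})"
    then obtain b where b: "\<forall>w\<in>A - {v}. 0 \<le> b w" "v = (\<Sum>w\<in>A - {v}. b w *s w)"
      using A(1) by (auto simp: cone_hull_finite)
    have "cone_hull A \<subseteq> cone_hull (A - {v})"
    proof
      fix x assume "x \<in> cone_hull A"
      then obtain c where c: "\<forall>w\<in>A. 0 \<le> c w" "x = (\<Sum>w\<in>A. c w *s w)"
        using A(1) by (auto simp: cone_hull_finite)
      have "x = c v *s (\<Sum>w\<in>A - {v}. b w *s w) + (\<Sum>w\<in>A - {v}. c w *s w)"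
        unfolding b(2)[symmetric] c(2) using A(1) that by (simp add: sum.remove)
      also have "\<dots> = (\<Sum>w\<in>A - {v}. (c v * b w + c w) *s w)"
        by (simp add: vec_eq_iff sum_component sum_distrib_left algebra_simps sum.distrib)
      finally show "x \<in> cone_hull (A - {v})"
        unfolding cone_hull_finite[OF finite_Diff[OF A(1)]] using b(1) c(1) that
        by (intro exI[of _ "\<lambda>w. c v * b w + c w"]) (auto intro!: add_nonneg_nonneg mult_nonneg_nonneg)
    qed
    moreover have "cone_hull (A - {v}) \<subseteq> cone_hull A"
      unfolding cone_hull_def by blast
    ultimately have "card A \<le> card (A - {v})"
      using A by (intro min) auto
    then show False using A(1) that by (metis card_Diff1_less linorder_not_less)
  qed
  with A show ?thesis using that by blast
qed

lemma zero_in_cone_hull: "0 \<in> cone_hull S"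
  unfolding cone_hull_def by (intro CollectI exI[of _ "{}"]) auto

text \<open>
  In a relation each summand is the negative of the sum of the others, so it lies in the cone
  and in its opposite.
\<close>
lemma strongly_convex_no_relation:
  assumes A: "finite A" "strongly_convex (cone_hull A)" "0 \<notin> A"
    and c: "\<And>w. w \<in> A \<Longrightarrow> 0 \<le> c w" "(\<Sum>w\<in>A. c w *s w) = 0" and "w \<in> A"
  shows "c w = 0"
proof -
  have "c w *s w \<in> cone_hull A"
    unfolding cone_hull_def using c(1) \<open>w \<in> A\<close>
    by (intro CollectI exI[of _ "{w}"] exI[of _ c]) auto
  moreover have "(\<Sum>w\<in>A - {w}. c w *s w) \<in> cone_hull A"
    unfolding cone_hull_def using c(1) A(1)
    by (intro CollectI exI[of _ "A - {w}"] exI[of _ c]) auto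
  moreover have "c w *s w = - (\<Sum>w\<in>A - {w}. c w *s w)"
    using c(2) A(1) \<open>w \<in> A\<close> by (simp add: sum.remove add_eq_0_iff2)
  ultimately have "c w *s w \<in> cone_hull A \<inter> uminus ` cone_hull A" by blast
  then have "c w *s w = 0" using A(2) unfolding strongly_convex_def by (metis singletonD)
  then show ?thesis using A(3) \<open>w \<in> A\<close> by (metis vec.scale_eq_0_iff)
qed

text \<open>
  A linear functional that kills \<open>v\<close> and is positive on the other generators exposes the ray of \<open>v\<close>. If
  there were none, a nonnegative combination of the other generators would be a multiple of \<open>v\<close>;
  a positive multiple contradicts minimality, any other multiple contradicts strong convexity.
\<close>
lemma minimal_generator_spans_ray:
  assumes A: "finite A" "strongly_convex (cone_hull A)" "0 \<notin> A"
    and v: "v \<in> A" "v \<notin> cone_hull (A - {v})"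
  shows "is_ray (cone_hull {v}) (cone_hull A)"
proof -
  let ?B = "A - {v}"
  have "v \<noteq> 0" using A(3) v(1) by blast
  have "\<not> (\<exists>c l. nonneg_nonzero ?B c \<and> (\<Sum>w\<in>?B. c w *s w) = l *s v)"
  proof safe
    fix c l assume c: "nonneg_nonzero ?B c" "(\<Sum>w\<in>?B. c w *s w) = l *s v"
    show False
    proof (cases "0 < l")
      case True
      have eq: "v = (\<Sum>w\<in>?B. (c w / l) *s w)"
        using arg_cong[OF c(2), of "\<lambda>x. (1 / l) *s x"] True
        by (simp add: vec.scale_sum_right)
      have "\<forall>w\<in>?B. 0 \<le> c w / l"
        using c(1) True by (simp add: nonneg_nonzero_def)
      then have "v \<in> cone_hull ?B"
        unfolding cone_hull_finite[OF finite_Diff[OF A(1)]]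
        using eq by (intro exI[of _ "\<lambda>w. c w / l"] conjI)
      then show False using v(2) by blast
    next
      case False
      let ?c = "c(v := - l)"
      have "(\<Sum>w\<in>?B. ?c w *s w) = (\<Sum>w\<in>?B. c w *s w)"
        by (intro sum.cong) auto
      then have "(\<Sum>w\<in>A. ?c w *s w) = 0"
        using A(1) v(1) c(2) by (simp add: sum.remove)
      then have zero: "?c w = 0" if "w \<in> A" for w
        using strongly_convex_no_relation[OF A, of ?c w] c(1) False that
        by (auto simp: nonneg_nonzero_def)
      obtain i where "i \<in> ?B" "c i \<noteq> 0" using c(1) by (auto simp: nonneg_nonzero_def)
      then show False using zero[of i] by simp
    qed
  qed
  then obtain u where u: "scalar_product v u = 0" "\<And>w. w \<in> ?B \<Longrightarrow> 0 < scalar_product w u"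
    using gordan_modulo_vector[OF gordan \<open>v \<noteq> 0\<close>, of ?B "\<lambda>w. w"] A(1)
    unfolding positive_functional_def by auto
  have "u \<in> dual_cone (cone_hull A)"
    unfolding dual_cone_hull using u by (force simp: dual_cone_def)
  moreover have "cone_hull {v} = {x \<in> cone_hull A. scalar_product x u = 0}"
  proof safe
    fix x assume "x \<in> cone_hull {v}"
    moreover have "cone_hull {v} \<subseteq> cone_hull A"
      unfolding cone_hull_def using v(1) by blast
    ultimately show "x \<in> cone_hull A" "scalar_product x u = 0"
      using u(1) by (auto simp: cone_hull_singleton scalar_product_scale_left)
  next
    fix x assume "x \<in> cone_hull A" and x: "scalar_product x u = 0"
    then obtain c where c: "\<forall>w\<in>A. 0 \<le> c w" "x = c v *s v + (\<Sum>w\<in>?B. c w *s w)"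
      using A(1) v(1) by (auto simp: cone_hull_finite sum.remove)
    have "(\<Sum>w\<in>?B. c w * scalar_product w u) = 0"
      using x u(1) by (simp add: c(2) scalar_product_add_left scalar_product_sum_left scalar_product_scale_left)
    then have "\<forall>w\<in>?B. c w * scalar_product w u = 0"
      using A(1) c(1) u(2) by (subst (asm) sum_nonneg_eq_0_iff) (auto simp: less_imp_le)
    then have "\<forall>w\<in>?B. c w = 0" using u(2) by force
    then have "x = c v *s v" using c(2) by simp
    then show "x \<in> cone_hull {v}"
      using c(1) v(1) by (auto simp: cone_hull_singleton)
  qed
  moreover have "vec.dim (cone_hull {v}) = 1"
    by (rule vec.dim_unique[of "{v}"])
       (use \<open>v \<noteq> 0\<close> subset_cone_hull[of "{v}"] in
         \<open>auto simp: cone_hull_singleton vec.span_singleton\<close>)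
  ultimately show ?thesis
    unfolding is_ray_def is_face_def by blast
qed

lemma scalar_product_rat_vec: "scalar_product (rat_vec v) (rat_vec u) = of_int (scalar_product v u)"
  by (simp add: scalar_product_def rat_vec_def)

lemma rat_vec_scale: "rat_vec (k *s u) = of_int k *s rat_vec u"
  by (simp add: rat_vec_def vec_eq_iff)

text \<open>
  Used to pass from exposing functionals and generators, which are rational, to lattice vectors.
\<close>
lemma clear_denominators:
  fixes v :: "rat^'n"
  obtains N w where "0 < N" "rat_vec w = of_int N *s v"
proof -
  have "\<exists>N>0. \<forall>i\<in>I. of_int N * v $ i \<in> \<int>" if "finite I" for I :: "'n set"
    using that
  proof induction
    case (insert i I)
    then obtain N where N: "0 < N" "\<forall>i\<in>I. of_int N * v $ i \<in> \<int>" by auto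
    obtain a b where ab: "quotient_of (v $ i) = (a, b)" by fastforce
    have b: "0 < b" "v $ i = of_int a / of_int b"
      using ab quotient_of_denom_pos quotient_of_div by auto
    have "of_int (N * b) * v $ j = of_int b * (of_int N * v $ j)" for j by simp
    moreover have "of_int (N * b) * v $ i = of_int (N * a)" using b by simp
    ultimately have "\<forall>j\<in>insert i I. of_int (N * b) * v $ j \<in> \<int>"
      using N(2) by (metis Ints_mult Ints_of_int insert_iff)
    then show ?case using N(1) b(1) by (metis mult_pos_pos)
  qed (auto intro: exI[of _ 1])
  from this[of UNIV] obtain N where N: "0 < N" "\<forall>i. of_int N * v $ i \<in> \<int>" by auto
  then have "\<forall>i. \<exists>k. of_int N * v $ i = of_int k" by (auto simp: Ints_def image_iff)
  then obtain f where f: "\<forall>i. of_int N * v $ i = of_int (f i)" by (rule choice[THEN exE])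
  then have "rat_vec (\<chi> i. f i) = of_int N *s v" by (simp add: rat_vec_def vec_eq_iff)
  then show ?thesis using that N(1) by blast
qed

text \<open>
  A lattice vector of least \<open>\<ell>\<^sup>1\<close>-norm on the open ray is primitive, since a proper divisor of it, up to sign,
  would be a shorter lattice vector on the same ray.
\<close>
lemma primitive_vector_exists:
  fixes v :: "rat^'n"
  assumes "v \<noteq> 0"
  obtains q c where "primitive_vector q (cone_hull {v})" "0 < c" "v = c *s rat_vec q"
proof -
  define on_ray where "on_ray q \<longleftrightarrow> (\<exists>c>0. rat_vec q = c *s v)" for q :: "int^'n"
  define size where "size q = (\<Sum>i\<in>UNIV. nat \<bar>q $ i\<bar>)" for q :: "int^'n"
  obtain N w where "0 < N" "rat_vec w = of_int N *s v" using clear_denominators .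
  then have "on_ray w" unfolding on_ray_def by (metis of_int_0_less_iff)
  then obtain q where q: "on_ray q" and min: "\<And>q'. on_ray q' \<Longrightarrow> size q \<le> size q'"
    using ex_has_least_nat by metis
  then obtain c where c: "0 < c" "rat_vec q = c *s v" unfolding on_ray_def by blast
  have "q \<noteq> 0"
  proof
    assume "q = 0"
    then have "c *s v = 0" using c(2) by (simp add: rat_vec_def vec_eq_iff)
    then show False using c(1) assms by simp
  qed
  have "\<bar>k\<bar> = 1" if kq: "q = k *s q'" for k q'
  proof -
    have "k \<noteq> 0" "q' \<noteq> 0" using \<open>q \<noteq> 0\<close> kq by auto
    have "of_int k *s rat_vec q' = c *s v" using c kq by (simp add: rat_vec_scale)
    then have *: "of_int k * of_int (q' $ i) = c * v $ i" for i
      by (simp add: vec_eq_iff rat_vec_def)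
    have "rat_vec (sgn k *s q') = (c / of_int \<bar>k\<bar>) *s v"
      using *[symmetric] \<open>k \<noteq> 0\<close> by (auto simp: vec_eq_iff rat_vec_def abs_if sgn_if field_simps)
    then have "on_ray (sgn k *s q')"
      unfolding on_ray_def using c(1) \<open>k \<noteq> 0\<close> by (metis divide_pos_pos of_int_0_less_iff zero_less_abs_iff)
    then have "size q \<le> size (sgn k *s q')" by (rule min)
    also have "size (sgn k *s q') = size q'"
      using \<open>k \<noteq> 0\<close> by (simp add: size_def abs_mult)
    finally have "size q \<le> size q'" .
    moreover have "size q = nat \<bar>k\<bar> * size q'"
      by (simp add: size_def kq abs_mult nat_mult_distrib sum_distrib_left)
    moreover have "0 < size q'"
      using \<open>q' \<noteq> 0\<close> by (auto simp: size_def vec_eq_iff intro!: sum_pos2)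
    ultimately have "nat \<bar>k\<bar> \<le> 1" by simp
    then show ?thesis using \<open>k \<noteq> 0\<close> by linarith
  qed
  then have "primitive_vector q (cone_hull {v})"
    using \<open>q \<noteq> 0\<close> c by (auto simp: primitive_vector_def cone_hull_singleton intro: less_imp_le)
  moreover have "v = (1 / c) *s rat_vec q" using c by (simp add: vec_eq_iff)
  ultimately show ?thesis using that c(1) by (metis divide_pos_pos zero_less_one)
qed

lemma weight_semigroup_generators:
  "\<sigma> = cone_hull A \<Longrightarrow> u \<in> weight_semigroup \<sigma> \<longleftrightarrow> (\<forall>v\<in>A. 0 \<le> scalar_product v (rat_vec u))"
  unfolding weight_semigroup_def by (simp add: dual_cone_hull) (simp add: dual_cone_def)

text \<open>
  It suffices to test \<open>u + e\<close> on primitive vectors of the rays spanned by a minimal generating set. On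
  \<open>p\<close> the positive value of \<open>u\<close> compensates the \<open>-1\<close> of \<open>e\<close>, by integrality; on the others both summands
  are nonnegative.
\<close>
lemma demazure_root_shift:
  assumes "polyhedral_cone \<sigma>" "strongly_convex \<sigma>" "demazure_root \<sigma> p e"
    and u: "u \<in> weight_semigroup \<sigma>" "0 < scalar_product p u"
  shows "u + e \<in> weight_semigroup \<sigma>"
proof -
  obtain A where A: "finite A" "\<sigma> = cone_hull A" "\<And>v. v \<in> A \<Longrightarrow> v \<notin> cone_hull (A - {v})"
    using minimal_generators assms(1) by metis
  have "0 \<notin> A" using A(3) zero_in_cone_hull by blast
  have "0 \<le> scalar_product v (rat_vec (u + e))" if "v \<in> A" for v
  proof -
    have "v \<noteq> 0" using \<open>0 \<notin> A\<close> that by blast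
    then obtain q c where q: "primitive_vector q (cone_hull {v})" "0 < c" "v = c *s rat_vec q"
      by (rule primitive_vector_exists)
    have "is_ray (cone_hull {v}) \<sigma>"
      using A assms(2) \<open>0 \<notin> A\<close> that by (auto intro: minimal_generator_spans_ray)
    then have "0 \<le> scalar_product q e" if "q \<noteq> p"
      using assms(3) q(1) that unfolding demazure_root_def by blast
    moreover have "scalar_product p e = -1" using assms(3) by (simp add: demazure_root_def)
    moreover have "0 \<le> scalar_product q u"
      using u(1) that q(2) unfolding weight_semigroup_generators[OF A(2)]
      by (auto simp: q(3) scalar_product_scale_left scalar_product_rat_vec zero_le_mult_iff)
    ultimately have "0 \<le> scalar_product q (u + e)"
      using u(2) by (cases "q = p") (auto simp: scalar_product_add_right)
    then show ?thesis
      using q(2) by (simp add: q(3) scalar_product_scale_left scalar_product_rat_vec)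
  qed
  then show ?thesis by (simp add: weight_semigroup_generators[OF A(2)])
qed

lemma mem_one_dimensional_cone:
  assumes "vec.dim \<rho> = 1" "v \<in> \<rho>" "v \<noteq> 0" "x \<in> \<rho>"
  obtains c where "x = c *s (v :: rat^'n)"
proof -
  have "\<rho> \<subseteq> vec.span {v}"
    by (rule vec.card_ge_dim_independent) (use assms in auto)
  then show ?thesis using assms(4) that by (auto simp: vec.span_singleton)
qed

section \<open>Shifting weights along Demazure roots\<close>

text \<open>
  This is what remains of the notion of a Demazure root once the cone is forgotten. It refers to
  the semigroup only, so that the monoid and its idempotents can be studied in terms of weights.
\<close>
definition lowering :: "(rat^'n) set \<Rightarrow> int^'n \<Rightarrow> int^'n \<Rightarrow> bool" where
  "lowering \<sigma> p e \<longleftrightarrow> scalar_product p e = -1 \<and>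
     (\<forall>u\<in>weight_semigroup \<sigma>. 0 < scalar_product p u \<longrightarrow> u + e \<in> weight_semigroup \<sigma>)"

lemma demazure_root_lowering:
  assumes "polyhedral_cone \<sigma>" "strongly_convex \<sigma>" "demazure_root \<sigma> p e"
  shows "lowering \<sigma> p e"
  unfolding lowering_def
proof (intro conjI ballI impI)
  show "scalar_product p e = -1" using assms(3) by (simp add: demazure_root_def)
qed (rule demazure_root_shift[OF assms])

section \<open>Faces of the weight semigroup\<close>

text \<open>
  The complement of such a set is a prime ideal of the semigroup; these are exactly the supports of points
  of the toric variety. Working with them instead of the faces of the cone avoids
  the correspondence between the two.
\<close>
definition weight_face :: "(rat^'n) set \<Rightarrow> (int^'n) set \<Rightarrow> bool" where
  "weight_face \<sigma> F \<longleftrightarrow> F \<subseteq> weight_semigroup \<sigma> \<and> 0 \<in> F \<and>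
     (\<forall>u\<in>weight_semigroup \<sigma>. \<forall>v\<in>weight_semigroup \<sigma>. u + v \<in> F \<longleftrightarrow> u \<in> F \<and> v \<in> F)"

text \<open>
  For a face \<open>F\<close> this says that \<open>e\<close> belongs to the group generated by \<open>F\<close>, as every element of that
  group is a difference of two elements of \<open>F\<close>.
\<close>
definition has_direction :: "(int^'n) set \<Rightarrow> int^'n \<Rightarrow> bool" where
  "has_direction F e \<longleftrightarrow> (\<exists>w\<in>F. w + e \<in> F)"

definition support :: "(rat^'n) set \<Rightarrow> (int^'n \<Rightarrow> 'k::field) \<Rightarrow> (int^'n) set" where
  "support \<sigma> x = {u \<in> weight_semigroup \<sigma>. x u \<noteq> 0}"

lemma weight_face_add_iff:
  "weight_face \<sigma> F \<Longrightarrow> u \<in> weight_semigroup \<sigma> \<Longrightarrow> v \<in> weight_semigroup \<sigma> \<Longrightarrow>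
     u + v \<in> F \<longleftrightarrow> u \<in> F \<and> v \<in> F"
  by (auto simp: weight_face_def)

lemma weight_semigroup_multiple: "u \<in> weight_semigroup \<sigma> \<Longrightarrow> int i *s u \<in> weight_semigroup \<sigma>"
proof (induction i)
  case (Suc i)
  have "int (Suc i) *s u = u + int i *s u" by (simp add: vec_eq_iff algebra_simps)
  then show ?case using Suc by (metis weight_semigroup_add)
qed (simp add: weight_semigroup_0)

lemma weight_face_multiple_iff:
  assumes "weight_face \<sigma> F" "u \<in> weight_semigroup \<sigma>"
  shows "int i *s u \<in> F \<longleftrightarrow> i = 0 \<or> u \<in> F"
proof (induction i)
  case (Suc i)
  have "int (Suc i) *s u = u + int i *s u" by (simp add: vec_eq_iff algebra_simps)
  then show ?case
    using Suc weight_face_add_iff[OF assms(1,2) weight_semigroup_multiple[OF assms(2)]] by auto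
qed (use assms in \<open>simp add: weight_face_def\<close>)

lemma toric_points_add:
  "x \<in> toric_points \<sigma> \<Longrightarrow> u \<in> weight_semigroup \<sigma> \<Longrightarrow> v \<in> weight_semigroup \<sigma> \<Longrightarrow> x (u + v) = x u * x v"
  by (auto simp: toric_points_def)

lemma toric_points_multiple:
  assumes "x \<in> toric_points \<sigma>" "u \<in> weight_semigroup \<sigma>"
  shows "x (int i *s u) = x u ^ i"
proof (induction i)
  case 0
  then show ?case using assms by (simp add: toric_points_def)
next
  case (Suc i)
  have "int (Suc i) *s u = u + int i *s u" by (simp add: vec_eq_iff algebra_simps)
  then show ?case
    using Suc toric_points_add[OF assms weight_semigroup_multiple[OF assms(2)]] by simp
qed

lemma toric_points_eqI:
  assumes "x \<in> toric_points \<sigma>" "y \<in> toric_points \<sigma>" "\<And>u. u \<in> weight_semigroup \<sigma> \<Longrightarrow> x u = y u"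
  shows "x = y"
  using assms by (auto simp: toric_points_def intro: extensionalityI)

lemma weight_face_support: "x \<in> toric_points \<sigma> \<Longrightarrow> weight_face \<sigma> (support \<sigma> x)"
  by (auto simp: weight_face_def support_def weight_semigroup_0 weight_semigroup_add toric_points_add)
     (auto simp: toric_points_def)

lemma weight_face_semigroup: "weight_face \<sigma> (weight_semigroup \<sigma>)"
  by (simp add: weight_face_def weight_semigroup_0 weight_semigroup_add)

text \<open>
  A face of the semigroup is recovered from the finite set of those generators of the cone that vanish on it.
  Given \<open>u\<close> that vanishes on these generators, some \<open>w\<close> in the face dominates \<open>u\<close> on all
  generators, so \<open>w - u\<close> is again a weight and \<open>w = u + (w - u)\<close> puts \<open>u\<close> in the face.
\<close>
lemma finite_weight_faces:
  assumes "polyhedral_cone \<sigma>"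
  shows "finite {F. weight_face \<sigma> F}"
proof -
  obtain A where A: "finite A" "\<sigma> = cone_hull A"
    using assms unfolding polyhedral_cone_def by blast
  define ann where "ann F = {v\<in>A. \<forall>u\<in>F. scalar_product v (rat_vec u) = 0}" for F :: "(int^'a) set"
  have recover: "F = {u \<in> weight_semigroup \<sigma>. \<forall>v\<in>ann F. scalar_product v (rat_vec u) = 0}"
    if F: "weight_face \<sigma> F" for F
  proof (intro equalityI subsetI)
    show "u \<in> {u \<in> weight_semigroup \<sigma>. \<forall>v\<in>ann F. scalar_product v (rat_vec u) = 0}" if "u \<in> F" for u
      using F that by (auto simp: weight_face_def ann_def)
  next
    fix u assume "u \<in> {u \<in> weight_semigroup \<sigma>. \<forall>v\<in>ann F. scalar_product v (rat_vec u) = 0}"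
    then have u: "u \<in> weight_semigroup \<sigma>" "\<And>v. v \<in> ann F \<Longrightarrow> scalar_product v (rat_vec u) = 0" by auto
    have "\<exists>w\<in>F. \<forall>v\<in>B. scalar_product v (rat_vec u) \<le> scalar_product v (rat_vec w)" if "B \<subseteq> A" for B
      using finite_subset[OF that A(1)] that
    proof (induction B rule: finite_induct)
      case empty
      then show ?case using F by (auto simp: weight_face_def)
    next
      case (insert v B)
      then obtain w where w: "w \<in> F" "\<forall>v\<in>B. scalar_product v (rat_vec u) \<le> scalar_product v (rat_vec w)"
        by auto
      have nonneg: "0 \<le> scalar_product v' (rat_vec w')" if "w' \<in> F" "v' \<in> insert v B" for v' w'
        using F that insert.prems weight_semigroup_generators[OF A(2)] by (auto simp: weight_face_def)
      obtain w' where w': "w' \<in> F" "scalar_product v (rat_vec u) \<le> scalar_product v (rat_vec w')"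
      proof (cases "v \<in> ann F")
        case True
        then show ?thesis using that w(1) u(2) by (auto simp: ann_def)
      next
        case False
        then obtain w0 where w0: "w0 \<in> F" "scalar_product v (rat_vec w0) \<noteq> 0"
          using insert.prems by (auto simp: ann_def)
        then have "0 < scalar_product v (rat_vec w0)" using nonneg[of w0 v] by auto
        then obtain k where "scalar_product v (rat_vec u) \<le> of_nat k * scalar_product v (rat_vec w0)"
          using ex_less_of_nat_mult less_imp_le by blast
        moreover have "int k *s w0 \<in> F"
          using F w0(1) weight_face_multiple_iff[OF F] by (auto simp: weight_face_def)
        ultimately show ?thesis
          using that[of "int k *s w0"] by (simp add: rat_vec_scale scalar_product_scale_right)
      qed
      have "w + w' \<in> F" using w(1) w'(1) F by (auto simp: weight_face_def)
      moreover have "scalar_product v' (rat_vec u) \<le> scalar_product v' (rat_vec (w + w'))"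
        if "v' \<in> insert v B" for v'
        using that w w' nonneg[of w v'] nonneg[of w' v']
        by (auto simp: rat_vec_add scalar_product_add_right intro: add_increasing add_increasing2)
      ultimately show ?case by blast
    qed
    from this[OF subset_refl] obtain w where w: "w \<in> F"
      "\<forall>v\<in>A. scalar_product v (rat_vec u) \<le> scalar_product v (rat_vec w)" by blast
    have "rat_vec (w - u) = rat_vec w - rat_vec u" by (simp add: rat_vec_def vec_eq_iff)
    then have "w - u \<in> weight_semigroup \<sigma>"
      using w(2) by (simp add: weight_semigroup_generators[OF A(2)] scalar_product_diff_right)
    then show "u \<in> F" using weight_face_add_iff[OF F u(1), of "w - u"] w(1) by simp
  qed
  have "inj_on ann {F. weight_face \<sigma> F}"
  proof (rule inj_onI)
    fix F G assume FG: "F \<in> {F. weight_face \<sigma> F}" "G \<in> {F. weight_face \<sigma> F}" "ann F = ann G"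
    have "F = {u \<in> weight_semigroup \<sigma>. \<forall>v\<in>ann F. scalar_product v (rat_vec u) = 0}"
      by (rule recover) (use FG in simp)
    also have "\<dots> = {u \<in> weight_semigroup \<sigma>. \<forall>v\<in>ann G. scalar_product v (rat_vec u) = 0}"
      by (simp only: FG(3))
    also have "\<dots> = G"
      by (rule recover[symmetric]) (use FG in simp)
    finally show "F = G" .
  qed
  moreover have "finite (ann ` {F. weight_face \<sigma> F})"
    by (rule finite_subset[of _ "Pow A"]) (auto simp: ann_def A(1))
  ultimately show ?thesis by (rule finite_imageD[rotated])
qed

section \<open>Irreducible components and finite closed covers\<close>

lemma irreducible_subset_of_finite_cover:
  assumes "irreducible_in T C" "finite \<A>" "\<And>A. A \<in> \<A> \<Longrightarrow> closedin T A" "C \<subseteq> \<Union>\<A>"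
  shows "\<exists>A\<in>\<A>. C \<subseteq> A"
  using assms(2-4)
proof (induction \<A>)
  case empty
  then show ?case using assms(1) by (auto simp: irreducible_in_def)
next
  case (insert A \<A>)
  have "closedin T (\<Union>\<A>)" using insert by (intro closedin_Union) auto
  then have "C \<subseteq> A \<or> C \<subseteq> \<Union>\<A>"
    using assms(1) insert.prems unfolding irreducible_in_def by (metis Union_insert insertI1)
  then show ?case using insert by auto
qed

text \<open>
  An irreducible set lies in a single member of a finite closed cover, so a maximal one equals it.
  This identifies the components of the variety of idempotents without deciding which members are maximal.
\<close>
lemma irreducible_component_in_cover:
  assumes "C \<in> irreducible_components T" "finite \<A>" "topspace T \<subseteq> \<Union>\<A>"
    and "\<And>A. A \<in> \<A> \<Longrightarrow> closedin T A" "\<And>A. A \<in> \<A> \<Longrightarrow> irreducible_in T A"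
  shows "C \<in> \<A>" "\<And>A. A \<in> \<A> \<Longrightarrow> C \<subseteq> A \<Longrightarrow> A = C"
proof -
  have C: "irreducible_in T C" "\<And>D. irreducible_in T D \<Longrightarrow> C \<subseteq> D \<Longrightarrow> D = C"
    using assms(1) by (auto simp: irreducible_components_def)
  show "A = C" if "A \<in> \<A>" "C \<subseteq> A" for A
    using C(2) assms(5) that by blast
  then show "C \<in> \<A>"
    using irreducible_subset_of_finite_cover[OF C(1) assms(2,4)] C(1) assms(3)
    unfolding irreducible_in_def by blast
qed

section \<open>The monoid of points\<close>

text \<open>
  Only the monomials matter here: they show that the comultiplication of a weight in \<open>S\<close> has its support in
  \<open>S \<times> S\<close>, where a pair of points is multiplicative.
\<close>
lemma keys_binomial_power:
  "Poly_Mapping.keys ((Poly_Mapping.single (0, e1) 1 + Poly_Mapping.single (e2, 0) 1 ::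
       (int^'n) \<times> (int^'n) \<Rightarrow>\<^sub>0 'k::field) ^ n) \<subseteq> (\<lambda>i. (int i *s e2, int (n - i) *s e1)) ` {..n}"
proof (induction n)
  case 0
  then show ?case by (auto simp: zero_prod_def)
next
  case (Suc n)
  let ?b = "Poly_Mapping.single (0, e1) 1 + Poly_Mapping.single (e2, 0) 1 :: (int^'n) \<times> (int^'n) \<Rightarrow>\<^sub>0 'k"
  show ?case
  proof
    fix k assume "k \<in> Poly_Mapping.keys (?b ^ Suc n)"
    then obtain a c where k: "k = a + c" "a \<in> Poly_Mapping.keys ?b" "c \<in> Poly_Mapping.keys (?b ^ n)"
      using keys_mult[of ?b "?b ^ n"] by auto
    obtain i where i: "i \<le> n" "c = (int i *s e2, int (n - i) *s e1)"
      using k(3) Suc by auto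
    have "a = (0, e1) \<or> a = (e2, 0)"
      using k(2) keys_add[of "Poly_Mapping.single (0, e1) (1::'k)" "Poly_Mapping.single (e2, 0) 1"] by auto
    then show "k \<in> (\<lambda>i. (int i *s e2, int (Suc n - i) *s e1)) ` {..Suc n}"
    proof
      assume "a = (0, e1)"
      then have "k = (int i *s e2, int (Suc n - i) *s e1)"
        using i k(1) by (simp add: vec_eq_iff algebra_simps)
      then show ?thesis using i(1) by auto
    next
      assume "a = (e2, 0)"
      then have "k = (int (Suc i) *s e2, int (Suc n - Suc i) *s e1)"
        using i k(1) by (simp add: vec_eq_iff algebra_simps)
      then show ?thesis using i(1) by blast
    qed
  qed
qed

lemma sum_delta_le:
  fixes f :: "nat \<Rightarrow> 'k::field"
  assumes "j \<le> n" "\<And>i. i \<le> n \<Longrightarrow> i \<noteq> j \<Longrightarrow> f i = 0"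
  shows "(\<Sum>i\<le>n. f i) = f j"
  using sum.mono_neutral_right[of "{..n}" "{j}" f] assms by auto

text \<open>
  The four values of the sum that multiplies \<open>x(u)\<close> in the square of \<open>x\<close>; \<open>a\<close> and \<open>b\<close> stand for
  the roots \<open>e\<^sub>1\<close> and \<open>e\<^sub>2\<close> belonging to the group of the support.
\<close>
lemma sum_choose_extreme:
  "(\<Sum>i\<le>h. of_nat (h choose i) * (if (i = 0 \<or> b) \<and> (i = h \<or> a) then 1 else 0 :: 'k::field)) =
     (if h = 0 then 1 else if a \<and> b then 2 ^ h else if a \<or> b then 1 else 0)"
proof (cases "h = 0")
  case False
  have single: "(\<Sum>i\<le>h. of_nat (h choose i) * (if i = j then 1 else 0)) = (of_nat (h choose j) :: 'k)"
    if "j \<le> h" for j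
    using that by (simp add: if_distrib cong: if_cong)
  have "(\<Sum>i\<le>h. of_nat (h choose i)) = (2 ^ h :: 'k)"
    using binomial_ring[of "1::'k" 1 h] by simp
  moreover have "(\<Sum>i\<le>h. of_nat (h choose i) * (if i = 0 \<and> i = h then 1 else 0 :: 'k)) = 0"
    using False by (intro sum.neutral) auto
  ultimately show ?thesis
    using False single[of 0] single[of h] by (cases a; cases b) auto
qed simp

locale lowering_pair =
  fixes \<sigma> :: "(rat^'n) set" and p e1 e2 :: "int^'n"
  assumes pairing_nonneg: "u \<in> weight_semigroup \<sigma> \<Longrightarrow> 0 \<le> scalar_product p u"
    and lowering1: "lowering \<sigma> p e1" and lowering2: "lowering \<sigma> p e2"
begin

abbreviation S :: "(int^'n) set" where "S \<equiv> weight_semigroup \<sigma>"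

definition height :: "int^'n \<Rightarrow> nat" where "height u = nat (scalar_product p u)"

lemma height_0 [simp]: "height 0 = 0"
  by (simp add: height_def scalar_product_def)

lemma height_add: "u \<in> S \<Longrightarrow> v \<in> S \<Longrightarrow> height (u + v) = height u + height v"
  by (simp add: height_def scalar_product_add_right nat_add_distrib pairing_nonneg)

lemma height_multiple: "height (int i *s u) = i * height u"
  by (simp add: height_def scalar_product_scale_right nat_mult_distrib)

lemma height_shift:
  "lowering \<sigma> p e \<Longrightarrow> height (u + int i *s e) = height u - i"
  by (simp add: height_def scalar_product_add_right scalar_product_scale_right lowering_def nat_diff_distrib')

lemma shift_mem:
  assumes "lowering \<sigma> p e" "u \<in> S" "i \<le> height u"
  shows "u + int i *s e \<in> S"
  using assms(3)
proof (induction i)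
  case (Suc i)
  have "0 < height (u + int i *s e)" using Suc.prems height_shift[OF assms(1)] by simp
  then have "u + int i *s e + e \<in> S"
    using Suc assms(1) by (simp add: lowering_def height_def)
  moreover have "u + int (Suc i) *s e = u + int i *s e + e" by (simp add: vec_eq_iff algebra_simps)
  ultimately show ?case by (simp only:)
qed (use assms(2) in simp)

lemmas shift_mem1 = shift_mem[OF lowering1] and shift_mem2 = shift_mem[OF lowering2]
lemmas height_shift1 = height_shift[OF lowering1] and height_shift2 = height_shift[OF lowering2]

lemma mixed_shift_mem:
  assumes "u \<in> S" "i \<le> height u"
  shows "u + int i *s e2 + int (height u - i) *s e1 \<in> S"
  by (intro shift_mem1 shift_mem2 assms) (simp add: height_shift2)

abbreviation star :: "(int^'n \<Rightarrow> 'k::field) \<Rightarrow> (int^'n \<Rightarrow> 'k) \<Rightarrow> int^'n \<Rightarrow> 'k" (infixl "\<star>" 70) where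
  "x \<star> y \<equiv> toric_mult \<sigma> p e1 e2 x y"

lemma star_apply:
  "u \<in> S \<Longrightarrow> (x \<star> y) u = (\<Sum>i\<le>height u. of_nat (height u choose i) *
     x (u + int i *s e2) * y (u + int (height u - i) *s e1))"
  by (simp add: toric_mult_def eval_at_comult height_def)

text \<open>
  The comultiplication turns addition of weights into multiplication in the group algebra, and
  evaluation at a pair of points is multiplicative on the algebra of \<open>S \<times> S\<close>.
\<close>
lemma star_closed:
  assumes x: "x \<in> toric_points \<sigma>" and y: "y \<in> toric_points \<sigma>"
  shows "x \<star> y \<in> toric_points \<sigma>"
proof -
  let ?xy = "\<lambda>(a, b). x a * y b"
  have keys: "Poly_Mapping.keys (comult p e1 e2 u :: _ \<Rightarrow>\<^sub>0 'a) \<subseteq> S \<times> S" if u: "u \<in> S" for u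
  proof
    fix k assume "k \<in> Poly_Mapping.keys (comult p e1 e2 u :: _ \<Rightarrow>\<^sub>0 'a)"
    then obtain a c where "k = a + c" "a \<in> Poly_Mapping.keys (Poly_Mapping.single (u, u) (1::'a))"
      and c: "c \<in> Poly_Mapping.keys ((Poly_Mapping.single (0, e1) 1 + Poly_Mapping.single (e2, 0) 1 ::
         _ \<Rightarrow>\<^sub>0 'a) ^ height u)"
      unfolding comult_def height_def[symmetric] using subsetD[OF keys_mult] by blast
    then have "k = (u, u) + c" by simp
    with subsetD[OF keys_binomial_power c]
    obtain i where "i \<le> height u" "k = (u + int i *s e2, u + int (height u - i) *s e1)"
      using keys_binomial_power[of e1 e2 "height u", where 'k='a] by auto
    then show "k \<in> S \<times> S"
      using shift_mem1[OF u, of "height u - i"] shift_mem2[OF u, of i] by (simp del: of_nat_diff)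
  qed
  have "(x \<star> y) (u + v) = (x \<star> y) u * (x \<star> y) v" if "u \<in> S" "v \<in> S" for u v
  proof -
    have "comult p e1 e2 (u + v) = (comult p e1 e2 u * comult p e1 e2 v :: _ \<Rightarrow>\<^sub>0 'a)"
    proof -
      have "Poly_Mapping.single (u + v, u + v) (1::'a) =
          Poly_Mapping.single (u, u) 1 * Poly_Mapping.single (v, v) 1"
        by (simp add: mult_single)
      then show ?thesis
        unfolding comult_def height_def[symmetric] height_add[OF that] power_add
        by (simp only: mult_ac)
    qed
    moreover have "eval_at ?xy (comult p e1 e2 u * comult p e1 e2 v) =
        eval_at ?xy (comult p e1 e2 u) * eval_at ?xy (comult p e1 e2 v)"
      by (rule eval_at_mult[where S = "S \<times> S"])
         (use keys that toric_points_add[OF x] toric_points_add[OF y] in auto)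
    ultimately show ?thesis
      using that by (simp add: toric_mult_def weight_semigroup_add)
  qed
  moreover have "(x \<star> y) 0 = 1"
    using x y by (simp add: star_apply weight_semigroup_0 toric_points_def)
  ultimately show ?thesis
    by (simp add: toric_points_def) (simp add: toric_mult_def)
qed

text \<open>
  Both sides are the trinomial sum over \<open>i + a + b = h\<close> with \<open>x\<close> shifted \<open>i + a\<close> times by
  \<open>e\<^sub>2\<close>, \<open>y\<close> shifted \<open>i\<close> times by \<open>e\<^sub>2\<close> and \<open>b\<close> times by \<open>e\<^sub>1\<close>, and \<open>z\<close> shifted \<open>a + b\<close> times by
  \<open>e\<^sub>1\<close>. The two bracketings differ in the order in which the trinomial coefficient is split.
\<close>
lemma star_assoc:
  fixes x y z :: "int^'n \<Rightarrow> 'k::field"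
  shows "x \<star> y \<star> z = x \<star> (y \<star> z)"
proof
  fix u
  show "(x \<star> y \<star> z) u = (x \<star> (y \<star> z)) u"
  proof (cases "u \<in> S")
    case False
    then show ?thesis by (simp add: toric_mult_def)
  next
    case u: True
    define h where "h = height u"
    define T :: "nat \<Rightarrow> nat \<Rightarrow> 'k" where
      "T i a = of_nat (h choose i) * of_nat (h - i choose a) * x (u + int i *s e2 + int a *s e2) *
         y (u + int i *s e2 + int (h - i - a) *s e1) * z (u + int (h - i) *s e1)" for i a
    have "(x \<star> y \<star> z) u = (\<Sum>i\<le>h. \<Sum>a\<le>h - i. T i a)"
      unfolding star_apply[OF u] h_def[symmetric]
    proof (intro sum.cong refl)
      fix i assume i: "i \<in> {..h}"
      show "of_nat (h choose i) * (x \<star> y) (u + int i *s e2) * z (u + int (h - i) *s e1) =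
          (\<Sum>a\<le>h - i. T i a)"
        using i u shift_mem2[of u i]
        by (simp add: star_apply height_shift2 T_def sum_distrib_left sum_distrib_right mult_ac
            del: of_nat_diff flip: h_def)
    qed
    also have "\<dots> = (\<Sum>(i, a)\<in>{(i, a). i + a \<le> h}. T i a)"
      by (subst sum.Sigma) (auto intro!: sum.cong)
    also have "\<dots> = (\<Sum>m\<le>h. \<Sum>i\<le>m. T i (m - i))"
      by (rule sum.triangle_reindex_eq)
    also have "\<dots> = (x \<star> (y \<star> z)) u"
      unfolding star_apply[OF u] h_def[symmetric]
    proof (intro sum.cong refl)
      fix m assume m: "m \<in> {..h}"
      have "T i (m - i) = of_nat (h choose m) * x (u + int m *s e2) * (of_nat (m choose i) *
          y (u + int (h - m) *s e1 + int i *s e2) *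
          z (u + int (h - m) *s e1 + int (m - i) *s e1))" if i: "i \<le> m" for i
      proof -
        have b: "of_nat (h choose i) * of_nat (h - i choose (m - i)) =
            (of_nat (h choose m) * of_nat (m choose i) :: 'k)"
          using choose_mult[OF i, of h] m by (simp flip: of_nat_mult)
        have xs: "u + int i *s e2 + int (m - i) *s e2 = u + int m *s e2"
          using i by (simp add: vec_eq_iff algebra_simps)
        have ys: "u + int i *s e2 + int (h - i - (m - i)) *s e1 = u + int (h - m) *s e1 + int i *s e2"
          using i by (simp add: algebra_simps)
        have zs: "u + int (h - i) *s e1 = u + int (h - m) *s e1 + int (m - i) *s e1"
          using i m by (simp add: vec_eq_iff algebra_simps)
        show ?thesis
          unfolding T_def b xs ys zs by (simp only: mult_ac)
      qed
      then show "(\<Sum>i\<le>m. T i (m - i)) =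
          of_nat (h choose m) * x (u + int m *s e2) * (y \<star> z) (u + int (h - m) *s e1)"
        using m u shift_mem1[of u "h - m"]
        by (simp add: star_apply height_shift1 sum_distrib_left
            del: of_nat_diff flip: h_def)
    qed
    finally show ?thesis .
  qed
qed

text \<open>
  For \<open>t = 0\<close> the convention \<open>0\<^sup>0 = 1\<close> makes this the indicator function of the weights of height 0 in
  \<open>F\<close>, the limit of the points with \<open>t \<noteq> 0\<close>.
\<close>
definition power_point :: "'k::field \<Rightarrow> (int^'n) set \<Rightarrow> int^'n \<Rightarrow> 'k" where
  "power_point t F = (\<lambda>u\<in>S. if u \<in> F then t ^ height u else 0)"

lemma power_point_apply: "u \<in> S \<Longrightarrow> power_point t F u = (if u \<in> F then t ^ height u else 0)"
  by (simp add: power_point_def)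

lemma power_point_closed: "weight_face \<sigma> F \<Longrightarrow> power_point t F \<in> toric_points \<sigma>"
  by (auto simp: toric_points_def power_point_def weight_semigroup_0 weight_semigroup_add
      weight_face_add_iff height_add power_add weight_face_def)

text \<open>
  The indicator of the weights of height 0 keeps only the term in which the first factor is shifted
  down to height 0, where the second factor is not shifted at all.
\<close>
lemma unit_star:
  assumes "y \<in> toric_points \<sigma>"
  shows "power_point 0 S \<star> y = y"
proof (rule toric_points_eqI)
  fix u assume u: "u \<in> S"
  show "(power_point 0 S \<star> y) u = y u"
    unfolding star_apply[OF u]
    by (subst sum_delta_le[of "height u"])
       (use u in \<open>auto simp: power_point_apply shift_mem2 height_shift2\<close>)
qed (use assms star_closed power_point_closed weight_face_semigroup in blast)+

lemma star_unit:
  assumes "y \<in> toric_points \<sigma>"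
  shows "y \<star> power_point 0 S = y"
proof (rule toric_points_eqI)
  fix u assume u: "u \<in> S"
  show "(y \<star> power_point 0 S) u = y u"
    unfolding star_apply[OF u]
    by (subst sum_delta_le[of 0])
       (use u in \<open>auto simp: power_point_apply shift_mem1 height_shift1 simp del: of_nat_diff\<close>)
qed (use assms star_closed power_point_closed weight_face_semigroup in blast)+

lemma toric_unit_eq: "toric_unit \<sigma> p e1 e2 = power_point 0 S"
  unfolding toric_unit_def
proof (rule the_equality)
  show "power_point 0 S \<in> toric_points \<sigma> \<and>
      (\<forall>x\<in>toric_points \<sigma>. power_point 0 S \<star> x = x \<and> x \<star> power_point 0 S = x)"
    by (simp add: unit_star star_unit power_point_closed weight_face_semigroup)
  fix z :: "int^'n \<Rightarrow> 'a"
  assume "z \<in> toric_points \<sigma> \<and> (\<forall>x\<in>toric_points \<sigma>. z \<star> x = x \<and> x \<star> z = x)"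
  then show "z = power_point 0 S"
    by (metis star_unit power_point_closed weight_face_semigroup)
qed

abbreviation X :: "(int^'n \<Rightarrow> 'k::field) monoid" where
  "X \<equiv> toric_monoid \<sigma> p e1 e2"

lemma X_simps: "carrier X = toric_points \<sigma>" "x \<otimes>\<^bsub>X\<^esub> y = x \<star> y" "\<one>\<^bsub>X\<^esub> = power_point 0 S"
  by (simp_all add: toric_monoid_def toric_unit_eq)

lemma monoid_X: "monoid (X :: (int^'n \<Rightarrow> 'k::field) monoid)"
  by (rule monoidI)
     (simp_all add: X_simps star_closed star_assoc unit_star star_unit power_point_closed
       weight_face_semigroup)

lemma star_apply_height_0: "u \<in> S \<Longrightarrow> height u = 0 \<Longrightarrow> (x \<star> y) u = x u * y u"
  by (simp add: star_apply)

lemma Units_nonzero: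
  assumes "g \<in> Units X" "u \<in> S" "height u = 0"
  shows "g u \<noteq> 0"
proof -
  obtain h where "g \<star> h = power_point 0 S"
    using assms(1) by (auto simp: Units_def X_simps)
  then have "g u * h u = 1"
    using star_apply_height_0[OF assms(2,3), of g h] assms by (simp add: power_point_apply)
  then show ?thesis by auto
qed

text \<open>
  If membership in \<open>F\<close> is insensitive to shifts by \<open>e\<^sub>1\<close>, the product at \<open>u \<in> F\<close> is the binomial
  expansion of \<open>(s + t)\<^sup>h\<close>. For \<open>F = S\<close> this makes \<open>s \<mapsto> power_point s S\<close> a homomorphism from
  the additive group, which acts on the line of every such \<open>F\<close> by translations.
\<close>
lemma power_point_translate_left:
  assumes "\<And>u i. u \<in> S \<Longrightarrow> i \<le> height u \<Longrightarrow> u + int i *s e1 \<in> F \<longleftrightarrow> u \<in> F"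
  shows "power_point s S \<star> power_point t F = power_point (s + t) F"
proof
  fix u
  show "(power_point s S \<star> power_point t F) u = power_point (s + t) F u"
  proof (cases "u \<in> S")
    case True
    then show ?thesis
      by (simp add: star_apply power_point_apply shift_mem1 shift_mem2 height_shift1 height_shift2 assms
          del: of_nat_diff)
         (simp add: add.commute[of s t] binomial_ring mult_ac)
  qed (simp add: toric_mult_def power_point_def)
qed

lemma power_point_translate_right:
  assumes "\<And>u i. u \<in> S \<Longrightarrow> i \<le> height u \<Longrightarrow> u + int i *s e2 \<in> F \<longleftrightarrow> u \<in> F"
  shows "power_point t F \<star> power_point s S = power_point (t + s) F"
proof
  fix u
  show "(power_point t F \<star> power_point s S) u = power_point (t + s) F u"
  proof (cases "u \<in> S")
    case True
    then show ?thesis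
      by (simp add: star_apply power_point_apply shift_mem1 shift_mem2 height_shift1 height_shift2 assms
          del: of_nat_diff)
         (simp add: add.commute[of t s] binomial_ring mult_ac)
  qed (simp add: toric_mult_def power_point_def)
qed

lemma power_point_S_unit: "power_point s S \<in> Units (X :: (int^'n \<Rightarrow> 'k::field) monoid)"
proof -
  have "power_point s S \<star> power_point (- s) S = power_point 0 S" for s :: 'k
    by (subst power_point_translate_left) (simp_all add: shift_mem1)
  from this[of s] this[of "- s"] show ?thesis
    by (auto simp: Units_def X_simps power_point_closed weight_face_semigroup
        intro!: bexI[of _ "power_point (- s) S"])
qed

section \<open>Idempotents\<close>

text \<open>
  If \<open>w\<close> and \<open>w + e\<close> lie in \<open>F\<close>, compare the two sides of \<open>(u + i e) + i w = u + i (w + e)\<close>.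
\<close>
lemma direction_shift_iff:
  assumes F: "weight_face \<sigma> F" and e: "lowering \<sigma> p e" and "has_direction F e"
    and u: "u \<in> S" "i \<le> height u"
  shows "u + int i *s e \<in> F \<longleftrightarrow> u \<in> F"
proof -
  obtain w where w: "w \<in> F" "w + e \<in> F" using assms(3) by (auto simp: has_direction_def)
  then have wS: "w \<in> S" "w + e \<in> S" using F by (auto simp: weight_face_def)
  have "(u + int i *s e) + int i *s w = u + int i *s (w + e)"
    by (simp add: vec_eq_iff algebra_simps)
  then have "u + int i *s e \<in> F \<and> int i *s w \<in> F \<longleftrightarrow> u \<in> F \<and> int i *s (w + e) \<in> F"
    using weight_face_add_iff[OF F] shift_mem[OF e u] u(1) wS weight_semigroup_multiple by metis
  then show ?thesis
    using w wS weight_face_multiple_iff[OF F] by blast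
qed

text \<open>
  From right to left this is two shifts inside \<open>F\<close>. From left to right, \<open>i (u + e\<^sub>2) + j (u + e\<^sub>1) + u\<close> equals
  the shifted weight plus \<open>(i + j) u\<close>, so \<open>F\<close> contains each of its summands, and a summand
  \<open>u + e\<^sub>2\<close> or \<open>u + e\<^sub>1\<close> that occurs exhibits the direction.
\<close>
lemma mixed_shift_iff:
  assumes F: "weight_face \<sigma> F" and u: "u \<in> F" "i \<le> height u"
  shows "u + int i *s e2 + int (height u - i) *s e1 \<in> F \<longleftrightarrow>
    (i = 0 \<or> has_direction F e2) \<and> (i = height u \<or> has_direction F e1)"
proof
  have uS: "u \<in> S" using F u(1) by (auto simp: weight_face_def)
  define j where "j = height u - i"
  let ?m = "u + int i *s e2 + int j *s e1"
  {
    assume "u + int i *s e2 + int (height u - i) *s e1 \<in> F"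
    then have m: "?m \<in> F" by (simp only: j_def)
    show "(i = 0 \<or> has_direction F e2) \<and> (i = height u \<or> has_direction F e1)"
    proof (cases "height u = 0")
      case True
      then show ?thesis using u(2) by simp
    next
      case False
      then have ue: "u + e1 \<in> S" "u + e2 \<in> S"
        using shift_mem1[OF uS, of 1] shift_mem2[OF uS, of 1] by auto
      have "int i *s (u + e2) + int j *s (u + e1) + u = ?m + int (i + j) *s u"
        by (simp add: vec_eq_iff algebra_simps)
      moreover have "?m + int (i + j) *s u \<in> F"
        using m u(1) F weight_face_multiple_iff[OF F uS]
        by (metis weight_face_add_iff weight_face_def subsetD)
      ultimately have "int i *s (u + e2) \<in> F \<and> int j *s (u + e1) \<in> F"
        using weight_face_add_iff[OF F] uS ue weight_semigroup_multiple weight_semigroup_add by metis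
      then have "(i = 0 \<or> u + e2 \<in> F) \<and> (j = 0 \<or> u + e1 \<in> F)"
        using weight_face_multiple_iff[OF F] ue by blast
      then show ?thesis
        using u unfolding has_direction_def j_def by auto
    qed
  next
    assume dirs: "(i = 0 \<or> has_direction F e2) \<and> (i = height u \<or> has_direction F e1)"
    have "u + int i *s e2 \<in> F"
      using dirs u uS direction_shift_iff[OF F lowering2] by (cases "i = 0") auto
    moreover have "u + int i *s e2 \<in> S" "j \<le> height (u + int i *s e2)"
      using shift_mem2[OF uS u(2)] by (simp_all add: height_shift2 j_def)
    moreover have "j = 0 \<or> has_direction F e1" using dirs by (auto simp: j_def)
    ultimately have "?m \<in> F"
      using direction_shift_iff[OF F lowering1] by (cases "j = 0") auto
    then show "u + int i *s e2 + int (height u - i) *s e1 \<in> F" by (simp only: j_def)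
  }
qed

text \<open>
  These are the faces that support idempotents.
\<close>
definition idempotent_face :: "(int^'n) set \<Rightarrow> bool" where
  "idempotent_face F \<longleftrightarrow> weight_face \<sigma> F \<and>
     ((\<forall>u\<in>F. height u = 0) \<or> has_direction F e1 \<noteq> has_direction F e2)"

text \<open>
  By multiplicativity \<open>x(u + i e\<^sub>2) x(u + j e\<^sub>1) = x(u) x(u + i e\<^sub>2 + j e\<^sub>1)\<close>, and for
  \<open>i + j = h\<close> the last factor is taken at height 0, where it only records membership in the support.
\<close>
lemma star_square:
  fixes x :: "int^'n \<Rightarrow> 'k::field"
  assumes x: "x \<in> toric_points \<sigma>"
    and base: "\<And>w. w \<in> S \<Longrightarrow> height w = 0 \<Longrightarrow> x w = 0 \<or> x w = 1"
    and u: "u \<in> support \<sigma> x"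
  shows "(x \<star> x) u = x u * (if height u = 0 then 1
     else if has_direction (support \<sigma> x) e1 \<and> has_direction (support \<sigma> x) e2 then 2 ^ height u
     else if has_direction (support \<sigma> x) e1 \<or> has_direction (support \<sigma> x) e2 then 1 else 0)"
proof -
  let ?F = "support \<sigma> x" and ?h = "height u"
  have uS: "u \<in> S" using u by (simp add: support_def)
  have "(x \<star> x) u = (\<Sum>i\<le>?h. x u * (of_nat (?h choose i) *
      (if (i = 0 \<or> has_direction ?F e2) \<and> (i = ?h \<or> has_direction ?F e1) then 1 else 0)))"
    unfolding star_apply[OF uS]
  proof (intro sum.cong refl)
    fix i assume "i \<in> {..?h}"
    then have i: "i \<le> ?h" by simp
    let ?a = "u + int i *s e2" and ?b = "u + int (?h - i) *s e1"
      and ?m = "u + int i *s e2 + int (?h - i) *s e1"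
    have mem: "?a \<in> S" "?b \<in> S" "?m \<in> S"
      using uS i by (auto intro: shift_mem1 shift_mem2 mixed_shift_mem simp del: of_nat_diff)
    have "x ?a * x ?b = x (?a + ?b)" by (simp only: toric_points_add[OF x mem(1,2)])
    also have "?a + ?b = u + ?m" by (simp only: ac_simps)
    also have "x (u + ?m) = x u * x ?m" by (simp only: toric_points_add[OF x uS mem(3)])
    finally have prod: "x ?a * x ?b = x u * x ?m" .
    have "height ?m = 0" by (simp add: height_shift1 height_shift2 del: of_nat_diff)
    then have "x ?m = (if ?m \<in> ?F then 1 else 0)"
      using base[OF mem(3)] mem(3) by (auto simp: support_def)
    then have "x ?m = (if (i = 0 \<or> has_direction ?F e2) \<and> (i = ?h \<or> has_direction ?F e1) then 1 else 0)"
      unfolding mixed_shift_iff[OF weight_face_support[OF x] u i] .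
    then show "of_nat (?h choose i) * x ?a * x ?b = x u * (of_nat (?h choose i) *
        (if (i = 0 \<or> has_direction ?F e2) \<and> (i = ?h \<or> has_direction ?F e1) then 1 else 0))"
      unfolding mult.assoc prod by (simp only: mult_ac)
  qed
  also have "\<dots> = x u * (\<Sum>i\<le>?h. of_nat (?h choose i) *
      (if (i = 0 \<or> has_direction ?F e2) \<and> (i = ?h \<or> has_direction ?F e1) then 1 else 0))"
    by (simp only: sum_distrib_left)
  finally show ?thesis unfolding sum_choose_extreme .
qed

lemma star_square_outside_support:
  assumes x: "x \<in> toric_points \<sigma>" and u: "u \<in> S" "x u = 0"
  shows "(x \<star> x) u = 0"
  unfolding star_apply[OF u(1)]
proof (intro sum.neutral ballI)
  fix i assume i: "i \<in> {..height u}"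
  let ?a = "u + int i *s e2" and ?b = "u + int (height u - i) *s e1"
    and ?m = "u + int i *s e2 + int (height u - i) *s e1"
  have mem: "?a \<in> S" "?b \<in> S" "?m \<in> S"
    using u i by (auto intro: shift_mem1 shift_mem2 mixed_shift_mem simp del: of_nat_diff)
  have "x ?a * x ?b = x (?a + ?b)" by (simp only: toric_points_add[OF x mem(1,2)])
  also have "?a + ?b = u + ?m" by (simp only: ac_simps)
  also have "x (u + ?m) = 0" by (simp only: toric_points_add[OF x u(1) mem(3)] u(2) mult_zero_left)
  finally show "of_nat (height u choose i) * x ?a * x ?b = 0" by (simp only: mult.assoc mult_zero_right)
qed

lemma idempotents_X: "x \<in> idempotents X \<longleftrightarrow> x \<in> toric_points \<sigma> \<and> x \<star> x = x"
  by (simp add: idempotents_def X_simps)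

text \<open>
  For \<open>t = 0\<close> the support consists of the weights of height 0 in \<open>F\<close>, for \<open>t \<noteq> 0\<close> it is \<open>F\<close>. Either way the
  factor by which squaring multiplies each nonzero value is 1.
\<close>
lemma power_point_idempotent:
  assumes "idempotent_face F"
  shows "power_point t F \<in> idempotents X"
proof -
  let ?x = "power_point t F"
  have F: "weight_face \<sigma> F" "F \<subseteq> S" using assms by (auto simp: idempotent_face_def weight_face_def)
  have x: "?x \<in> toric_points \<sigma>" by (rule power_point_closed[OF F(1)])
  have "(?x \<star> ?x) u = ?x u" if u: "u \<in> S" for u
  proof (cases "u \<in> support \<sigma> ?x")
    case False
    then show ?thesis using star_square_outside_support[OF x u] u by (simp add: support_def)
  next
    case True
    have "height u = 0 \<or> has_direction (support \<sigma> ?x) e1 \<noteq> has_direction (support \<sigma> ?x) e2"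
    proof (cases "t = 0 \<or> (\<forall>u\<in>F. height u = 0)")
      case True
      then show ?thesis
        using \<open>u \<in> support \<sigma> ?x\<close> by (auto simp: support_def power_point_def split: if_splits)
    next
      case False
      then have "support \<sigma> ?x = F" using F(2) by (auto simp: support_def power_point_def)
      then show ?thesis using assms False by (auto simp: idempotent_face_def)
    qed
    then show ?thesis
      using star_square[OF x _ True] by (auto simp: power_point_apply)
  qed
  then show ?thesis
    using x star_closed[OF x x] toric_points_eqI by (auto simp: idempotents_X)
qed

text \<open>
  The character of such a weight \<open>w\<close> of height 1 is the coordinate \<open>t\<close> on the line of \<open>F\<close>. It arises from any
  weight of positive height by shifting it down in the direction that \<open>F\<close> has. If \<open>F\<close> lies at height
  0, the line is a point and every \<open>w\<close> serves.
\<close>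
lemma idempotent_face_parameter:
  assumes "idempotent_face F"
  obtains w where "w \<in> F" "(\<forall>u\<in>F. height u = 0) \<or> height w = 1"
proof (cases "\<forall>u\<in>F. height u = 0")
  case True
  then show ?thesis using that[of 0] assms by (auto simp: idempotent_face_def weight_face_def)
next
  case False
  then obtain u where u: "u \<in> F" "height u \<noteq> 0" by auto
  have F: "weight_face \<sigma> F" using assms by (simp add: idempotent_face_def)
  obtain e where e: "lowering \<sigma> p e" "has_direction F e"
    using assms False lowering1 lowering2 unfolding idempotent_face_def by blast
  have "u + int (height u - 1) *s e \<in> F"
    using direction_shift_iff[OF F e, of u "height u - 1"] u F by (auto simp: weight_face_def simp del: of_nat_diff)
  moreover have "height (u + int (height u - 1) *s e) = 1"
    using u(2) by (simp add: height_shift[OF e(1)] del: of_nat_diff)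
  ultimately show ?thesis using that by blast
qed

text \<open>
  The factor that multiplies \<open>x(u)\<close> in the square must be 1, and \<open>2\<^sup>h \<noteq> 1\<close> in characteristic 0; this
  settles the support. For the values, let \<open>e\<close> be the direction of the support and \<open>w\<close> a weight of height 1 in it. Both
  \<open>w + e\<close> and \<open>u + h e\<close> have height 0 and value 1, so \<open>u + h (w + e) = (u + h e) + h w\<close>
  gives \<open>x(u) = x(w)\<^sup>h\<close>.
\<close>
lemma idempotentD:
  fixes x :: "int^'n \<Rightarrow> 'k::field_char_0"
  assumes "x \<in> idempotents X"
  shows "idempotent_face (support \<sigma> x)" "\<exists>t. x = power_point t (support \<sigma> x)"
proof -
  let ?F = "support \<sigma> x"
  have x: "x \<in> toric_points \<sigma>" "x \<star> x = x" using assms by (auto simp: idempotents_X)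
  have F: "weight_face \<sigma> ?F" by (rule weight_face_support[OF x(1)])
  have base: "x w = 0 \<or> x w = 1" if "w \<in> S" "height w = 0" for w
    using star_apply_height_0[OF that, of x x] x(2) by simp
  have two_power: "2 ^ h \<noteq> (1 :: 'k)" if "h \<noteq> 0" for h :: nat
  proof -
    have "2 ^ h \<noteq> (1::nat)" using that by simp
    then show ?thesis by (metis of_nat_1 of_nat_eq_iff of_nat_numeral of_nat_power)
  qed
  show idem: "idempotent_face ?F"
    unfolding idempotent_face_def
  proof (intro conjI F, rule ccontr)
    assume "\<not> ((\<forall>u\<in>?F. height u = 0) \<or> has_direction ?F e1 \<noteq> has_direction ?F e2)"
    then obtain u where u: "u \<in> ?F" "height u \<noteq> 0" "has_direction ?F e1 = has_direction ?F e2" by auto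
    have "x u \<noteq> 0" using u(1) by (simp add: support_def)
    then show False
      using star_square[OF x(1) base u(1)] x(2) u(2,3) two_power[OF u(2)]
      by (auto split: if_splits)
  qed
  obtain w where w: "w \<in> ?F" "(\<forall>u\<in>?F. height u = 0) \<or> height w = 1"
    using idempotent_face_parameter[OF idem] .
  have FS: "u \<in> S" if "u \<in> ?F" for u using that by (simp add: support_def)
  have base1: "x u = 1" if "u \<in> ?F" "height u = 0" for u
    using base[OF FS] that by (auto simp: support_def)
  have "x u = x w ^ height u" if u: "u \<in> ?F" for u
  proof (cases "height u = 0")
    case False
    then have w1: "height w = 1" using w(2) u by auto
    obtain e where e: "lowering \<sigma> p e" "has_direction ?F e"
      using idem False u lowering1 lowering2 unfolding idempotent_face_def by metis
    have we: "w + e \<in> ?F" "height (w + e) = 0"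
      using direction_shift_iff[OF F e FS[OF w(1)], of 1] height_shift[OF e(1), of w 1] w(1) w1 by auto
    have ue: "u + int (height u) *s e \<in> ?F" "height (u + int (height u) *s e) = 0"
      using direction_shift_iff[OF F e FS[OF u], of "height u"] height_shift[OF e(1), of u "height u"] u
      by auto
    have "u + int (height u) *s (w + e) = (u + int (height u) *s e) + int (height u) *s w"
      by (simp add: vec_eq_iff algebra_simps)
    then have "x u * x (w + e) ^ height u = x (u + int (height u) *s e) * x w ^ height u"
      using toric_points_add[OF x(1)] toric_points_multiple[OF x(1)] weight_semigroup_multiple
        FS[OF u] FS[OF w(1)] FS[OF we(1)] FS[OF ue(1)] by metis
    then show ?thesis using base1[OF we] base1[OF ue] by simp
  qed (use base1 u in simp)
  then have "x = power_point (x w) ?F"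
    by (intro toric_points_eqI[OF x(1) power_point_closed[OF F]])
       (auto simp: power_point_apply support_def)
  then show "\<exists>t. x = power_point t ?F" ..
qed

definition power_line :: "(int^'n) set \<Rightarrow> (int^'n \<Rightarrow> 'k::field) set" where
  "power_line F = range (\<lambda>t. power_point t F)"

lemma idempotents_eq_Union_lines:
  "idempotents (X :: (int^'n \<Rightarrow> 'k::field_char_0) monoid) = \<Union>(power_line ` {F. idempotent_face F})"
proof (intro equalityI subsetI)
  fix x :: "int^'n \<Rightarrow> 'k" assume x: "x \<in> idempotents X"
  obtain t where "x = power_point t (support \<sigma> x)" using idempotentD(2)[OF x] by blast
  then have "x \<in> power_line (support \<sigma> x)" unfolding power_line_def by (rule range_eqI)
  then show "x \<in> \<Union>(power_line ` {F. idempotent_face F})" using idempotentD(1)[OF x] by blast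
qed (auto simp: power_line_def power_point_idempotent)

lemma support_power_point:
  "F \<subseteq> S \<Longrightarrow> t \<noteq> 0 \<Longrightarrow> support \<sigma> (power_point t F) = F"
  by (auto simp: support_def power_point_def)

lemma idempotents_with_support:
  assumes F: "idempotent_face F" and u: "u \<in> F" "height u \<noteq> 0"
  shows "{x \<in> idempotents X. support \<sigma> x = F} =
    (\<lambda>t. power_point t F :: int^'n \<Rightarrow> 'k::field_char_0) ` (- {0})"
proof -
  have FS: "F \<subseteq> S" using F by (auto simp: idempotent_face_def weight_face_def)
  have "x \<in> (\<lambda>t. power_point t F) ` (- {0})"
    if x: "x \<in> idempotents X" "support \<sigma> x = F" for x :: "int^'n \<Rightarrow> 'k"
  proof -
    obtain t where t: "x = power_point t F" using idempotentD(2)[OF x(1)] x(2) by auto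
    have "x u \<noteq> 0" using u(1) x(2) by (auto simp: support_def)
    then have "t \<noteq> 0" using t u FS by (auto simp: power_point_def split: if_splits)
    then show ?thesis using t by blast
  qed
  then show ?thesis
    using power_point_idempotent[OF F] support_power_point[OF FS] by auto
qed

text \<open>
  These are polynomial equations for the line. They are expressed by \<open>h w\<close> instead of the
  \<open>h\<close>-th power of \<open>x(w)\<close>, so that each is a difference of two characters.
\<close>
lemma mem_power_line_iff:
  assumes F: "weight_face \<sigma> F" and w: "w \<in> F" "(\<forall>u\<in>F. height u = 0) \<or> height w = 1"
  shows "x \<in> power_line F \<longleftrightarrow> x \<in> toric_points \<sigma> \<and> (\<forall>u\<in>S - F. x u = 0) \<and>
    (\<forall>u\<in>F. x u = x (int (height u) *s w))"
proof
  have FS: "F \<subseteq> S" using F by (simp add: weight_face_def)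
  have wS: "w \<in> S" using FS w(1) by blast
  {
    assume "x \<in> power_line F"
    then obtain t where t: "x = power_point t F" by (auto simp: power_line_def)
    have "x u = x (int (height u) *s w)" if u: "u \<in> F" for u
    proof -
      have "height (int (height u) *s w) = height u"
        using w(2) u by (auto simp: height_multiple)
      then show ?thesis
        using u FS weight_face_multiple_iff[OF F wS] weight_semigroup_multiple[OF wS] w(1)
        by (auto simp: t power_point_apply)
    qed
    then show "x \<in> toric_points \<sigma> \<and> (\<forall>u\<in>S - F. x u = 0) \<and> (\<forall>u\<in>F. x u = x (int (height u) *s w))"
      using power_point_closed[OF F] by (auto simp: t power_point_apply)
  next
    assume x: "x \<in> toric_points \<sigma> \<and> (\<forall>u\<in>S - F. x u = 0) \<and> (\<forall>u\<in>F. x u = x (int (height u) *s w))"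
    then have "x u = power_point (x w) F u" if "u \<in> S" for u
      using that wS toric_points_multiple[of x] by (auto simp: power_point_apply)
    then have "x = power_point (x w) F"
      using x power_point_closed[OF F] toric_points_eqI by blast
    then show "x \<in> power_line F" unfolding power_line_def by blast
  }
qed

lemma closedin_power_line:
  assumes "idempotent_face F"
  shows "closedin (zariski \<sigma>) (power_line F :: (int^'n \<Rightarrow> 'k::field) set)"
proof -
  obtain w where w: "w \<in> F" "(\<forall>u\<in>F. height u = 0) \<or> height w = 1"
    using idempotent_face_parameter[OF assms] .
  have F: "weight_face \<sigma> F" using assms by (simp add: idempotent_face_def)
  then have FS: "F \<subseteq> S" by (simp add: weight_face_def)
  then have wS: "w \<in> S" using w(1) by blast
  let ?g = "\<lambda>u. Poly_Mapping.single u 1 + Poly_Mapping.single (int (height u) *s w) (-1) :: _ \<Rightarrow>\<^sub>0 'k"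
  let ?E = "(\<lambda>u. Poly_Mapping.single u 1) ` (S - F) \<union> ?g ` F"
  have "Poly_Mapping.keys (?g u) \<subseteq> S" if "u \<in> F" for u
    using keys_add[of "Poly_Mapping.single u (1::'k)"] weight_semigroup_multiple[OF wS] that FS
    by fastforce
  then have "?E \<subseteq> coordinate_ring \<sigma>"
    by (auto simp: coordinate_ring_def)
  moreover have "power_line F = {x \<in> toric_points \<sigma>. \<forall>f\<in>?E. eval_at x f = 0}"
    by (auto simp: mem_power_line_iff[OF F w] ball_Un eval_at_add)
  ultimately show ?thesis unfolding closedin_zariski by blast
qed

lemma flat_power_line:
  assumes "\<forall>u\<in>F. height u = 0"
  shows "power_line F = {power_point t F}"
proof -
  have "power_point s F = power_point t F" for s using assms by (auto simp: power_point_def)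
  then show ?thesis by (auto simp: power_line_def)
qed

text \<open>
  A common point determines the weights of height 0 in both faces, so these agree. If one face lies at
  height 0, its line is the common point. Otherwise the two faces have a common direction \<open>e\<close>, and
  \<open>u\<close> belongs to either of them exactly if the weight \<open>u + h e\<close> of height 0 does.
\<close>
lemma power_lines_comparable:
  fixes x :: "int^'n \<Rightarrow> 'k::field"
  assumes F: "idempotent_face F" and G: "idempotent_face G"
    and x: "x \<in> power_line F" "x \<in> power_line G"
  shows "power_line F \<subseteq> (power_line G :: (int^'n \<Rightarrow> 'k) set) \<or>
    power_line G \<subseteq> (power_line F :: (int^'n \<Rightarrow> 'k) set)"
proof -
  have Fw: "weight_face \<sigma> F" "F \<subseteq> S" and Gw: "weight_face \<sigma> G" "G \<subseteq> S"
    using F G by (auto simp: idempotent_face_def weight_face_def)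
  obtain s where s: "x = power_point s F" using x(1) by (auto simp: power_line_def)
  obtain t where t: "x = power_point t G" using x(2) by (auto simp: power_line_def)
  have base: "u \<in> F \<longleftrightarrow> u \<in> G" if "u \<in> S" "height u = 0" for u
    using fun_cong[OF trans[OF s[symmetric] t], of u] that by (auto simp: power_point_apply split: if_splits)
  show ?thesis
  proof (cases "(\<forall>u\<in>F. height u = 0) \<or> (\<forall>u\<in>G. height u = 0)")
    case True
    then have "power_line F = {x} \<or> power_line G = {x}"
      using flat_power_line[of F s] flat_power_line[of G t] s t by auto
    then show ?thesis using x by (elim disjE) simp_all
  next
    case False
    obtain w where w: "w \<in> F" "height w = 1"
      using idempotent_face_parameter[OF F] False by metis
    obtain w' where w': "w' \<in> G" "height w' = 1"
      using idempotent_face_parameter[OF G] False by metis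
    have shift1: "height (w + e) = 0" "w + e \<in> S" "height (w' + e) = 0" "w' + e \<in> S"
      "has_direction F e \<longleftrightarrow> w + e \<in> F" "has_direction G e \<longleftrightarrow> w' + e \<in> G"
      if e: "lowering \<sigma> p e" for e
      using w w' Fw Gw height_shift[OF e, of _ 1] shift_mem[OF e, of _ 1]
        direction_shift_iff[OF Fw(1) e, of w 1] direction_shift_iff[OF Gw(1) e, of w' 1]
      by (auto simp: has_direction_def)
    \<comment> \<open>The weight \<open>(w + e) + (w' + e') = (w + e') + (w' + e)\<close> lies in \<open>G\<close>, hence so does \<open>w' + e\<close>.\<close>
    have same: "has_direction G e"
      if e: "lowering \<sigma> p e" "has_direction F e" and e': "lowering \<sigma> p e'" "\<not> has_direction F e'" "has_direction G e'"
      for e e'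
    proof -
      have "w + e \<in> G" "w' + e' \<in> G" using base shift1[OF e(1)] shift1[OF e'(1)] e e' by auto
      then have "(w + e) + (w' + e') \<in> G" using Gw by (auto simp: weight_face_def)
      moreover have "(w + e) + (w' + e') = (w + e') + (w' + e)" by (simp only: ac_simps)
      ultimately have "w' + e \<in> G"
        using weight_face_add_iff[OF Gw(1) shift1(2)[OF e'(1)] shift1(4)[OF e(1)]] by simp
      then show ?thesis using shift1[OF e(1)] by simp
    qed
    have dirs: "has_direction F e1 \<noteq> has_direction F e2" "has_direction G e1 \<noteq> has_direction G e2"
      using F G False by (auto simp: idempotent_face_def)
    obtain e where e: "lowering \<sigma> p e" "has_direction F e" "has_direction G e"
      using dirs same lowering1 lowering2 by metis
    have "u \<in> F \<longleftrightarrow> u \<in> G" if "u \<in> S" for u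
      using direction_shift_iff[OF Fw(1) e(1,2) that, of "height u"]
        direction_shift_iff[OF Gw(1) e(1,3) that, of "height u"]
        base[OF shift_mem[OF e(1) that, of "height u"]] height_shift[OF e(1), of u "height u"] by simp
    then have "F = G" using Fw Gw by blast
    then show ?thesis by simp
  qed
qed

section \<open>Lines of idempotents as subvarieties\<close>

definition restrict_to_line :: "(int^'n) set \<Rightarrow> ((int^'n) \<Rightarrow>\<^sub>0 'k::field) \<Rightarrow> 'k poly" where
  "restrict_to_line F f =
     (\<Sum>u\<in>Poly_Mapping.keys f. if u \<in> F then monom (Poly_Mapping.lookup f u) (height u) else 0)"

lemma eval_at_power_point:
  "f \<in> coordinate_ring \<sigma> \<Longrightarrow> eval_at (power_point t F) f = poly (restrict_to_line F f) t"
  unfolding eval_at_def restrict_to_line_def poly_sum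
  by (intro sum.cong refl) (auto simp: coordinate_ring_def power_point_apply poly_monom subset_iff)

text \<open>
  A polynomial that vanishes at all \<open>t \<noteq> 0\<close> of an infinite field is zero.
\<close>
lemma vanishing_on_punctured_line:
  fixes f :: "(int^'n) \<Rightarrow>\<^sub>0 'k::field_char_0"
  assumes f: "f \<in> coordinate_ring \<sigma>" and "\<And>t. t \<noteq> 0 \<Longrightarrow> eval_at (power_point t F) f = 0"
  shows "eval_at (power_point t F) f = 0"
proof -
  have "infinite (- {0 :: 'k})" by (simp add: infinite_UNIV_char_0 finite_compl Compl_eq_Diff_UNIV)
  moreover have "- {0} \<subseteq> {t. poly (restrict_to_line F f) t = 0}"
    using assms eval_at_power_point[OF f] by auto
  ultimately have "restrict_to_line F f = 0"
    using poly_roots_finite finite_subset by blast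
  then show ?thesis by (simp add: eval_at_power_point[OF f])
qed

lemma closure_of_punctured_line:
  assumes F: "idempotent_face F"
  shows "zariski \<sigma> closure_of ((\<lambda>t. power_point t F :: int^'n \<Rightarrow> 'k::field_char_0) ` (- {0})) =
    power_line F"
proof
  let ?P = "(\<lambda>t. power_point t F :: int^'n \<Rightarrow> 'k) ` (- {0})"
  have Fw: "weight_face \<sigma> F" using F by (simp add: idempotent_face_def)
  show "zariski \<sigma> closure_of ?P \<subseteq> power_line F"
    by (rule closure_of_minimal[OF _ closedin_power_line[OF F]]) (auto simp: power_line_def)
  have "?P \<subseteq> topspace (zariski \<sigma>)"
    using power_point_closed[OF Fw] by (auto simp: topspace_zariski)
  then have sub: "?P \<subseteq> zariski \<sigma> closure_of ?P" by (rule closure_of_subset)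
  obtain E where E: "E \<subseteq> coordinate_ring \<sigma>"
    "zariski \<sigma> closure_of ?P = {x \<in> toric_points \<sigma>. \<forall>f\<in>E. eval_at x f = 0}"
    using closedin_closure_of[of "zariski \<sigma>" ?P] unfolding closedin_zariski by blast
  have "eval_at (power_point t F) f = 0" if "f \<in> E" for t :: 'k and f
  proof (rule vanishing_on_punctured_line)
    show "f \<in> coordinate_ring \<sigma>" using E(1) that by blast
    show "eval_at (power_point t F) f = 0" if "t \<noteq> 0" for t :: 'k
      using sub E(2) that \<open>f \<in> E\<close> by blast
  qed
  then show "power_line F \<subseteq> zariski \<sigma> closure_of ?P"
    unfolding E(2) power_line_def using power_point_closed[OF Fw] by auto
qed

text \<open>
  Functions restrict to polynomials in \<open>t\<close>, which have no zero divisors and are determined by their values.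
\<close>
lemma irreducible_power_line:
  fixes E :: "(int^'n \<Rightarrow> 'k::field_char_0) set"
  assumes F: "weight_face \<sigma> F" and sub: "power_line F \<subseteq> E"
  shows "irreducible_in (subtopology (zariski \<sigma>) E) (power_line F)"
  unfolding irreducible_in_def
proof (intro conjI allI impI)
  have points: "power_point t F \<in> toric_points \<sigma>" for t :: 'k by (rule power_point_closed[OF F])
  show "power_line F \<subseteq> topspace (subtopology (zariski \<sigma>) E)"
    using sub points by (auto simp: topspace_zariski power_line_def)
  show "power_line F \<noteq> ({} :: (int^'n \<Rightarrow> 'k) set)" by (simp add: power_line_def)
  fix A B assume AB: "closedin (subtopology (zariski \<sigma>) E) A \<and> closedin (subtopology (zariski \<sigma>) E) B \<and>
    power_line F \<subseteq> A \<union> B"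
  obtain f g where A: "f \<subseteq> coordinate_ring \<sigma>" "A = {x \<in> toric_points \<sigma>. \<forall>h\<in>f. eval_at x h = 0} \<inter> E"
    and B: "g \<subseteq> coordinate_ring \<sigma>" "B = {x \<in> toric_points \<sigma>. \<forall>h\<in>g. eval_at x h = 0} \<inter> E"
    using AB unfolding closedin_subtopology closedin_zariski by blast
  show "power_line F \<subseteq> A \<or> power_line F \<subseteq> B"
  proof (rule ccontr)
    assume "\<not> (power_line F \<subseteq> A \<or> power_line F \<subseteq> B)"
    then obtain s t where "power_point s F \<notin> A" "power_point t F \<notin> B"
      by (auto simp: power_line_def)
    moreover have "power_point r F \<in> E" for r using sub by (auto simp: power_line_def)
    ultimately obtain a b where a: "a \<in> f" "eval_at (power_point s F) a \<noteq> 0"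
      and b: "b \<in> g" "eval_at (power_point t F) b \<noteq> 0"
      using points by (auto simp: A(2) B(2))
    have ab: "a \<in> coordinate_ring \<sigma>" "b \<in> coordinate_ring \<sigma>" using A(1) B(1) a(1) b(1) by auto
    have "poly (restrict_to_line F a * restrict_to_line F b) r = 0" for r
    proof -
      have "power_point r F \<in> A \<union> B" using AB by (auto simp: power_line_def)
      then have "eval_at (power_point r F) a = 0 \<or> eval_at (power_point r F) b = 0"
        using a(1) b(1) by (auto simp: A(2) B(2))
      then show ?thesis by (auto simp: eval_at_power_point ab)
    qed
    then have "restrict_to_line F a * restrict_to_line F b = 0"
      using poly_all_0_iff_0 by blast
    then show False using a(2) b(2) by (auto simp: eval_at_power_point ab)
  qed
qed

text \<open>
  The character of \<open>w\<close> inverts the parametrization of the line by \<open>t\<close>.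
\<close>
lemma power_line_isomorphic_affine_line:
  assumes F: "weight_face \<sigma> F" and w: "w \<in> F" "height w = 1"
  shows "variety_isomorphic (subvariety \<sigma> (power_line F)) (affine_line :: ('k::field, 'k) variety)"
proof -
  have wS: "w \<in> S" using F w(1) by (auto simp: weight_face_def)
  have at_w: "power_point t F w = t" for t :: 'k using w wS by (simp add: power_point_apply)
  have "variety_morphism (subvariety \<sigma> (power_line F)) (affine_line :: ('k, 'k) variety) (\<lambda>x. x w)"
    unfolding variety_morphism_def subvariety_def affine_line_def fst_conv snd_conv
  proof (intro conjI ballI)
    fix f :: "'k \<Rightarrow> 'k" assume "f \<in> range poly"
    then obtain q where q: "f = poly q" by auto
    let ?f = "\<Sum>i\<le>degree q. Poly_Mapping.single (int i *s w) (coeff q i)"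
    have "?f \<in> coordinate_ring \<sigma>"
      using keys_sum[of "\<lambda>i. Poly_Mapping.single (int i *s w) (coeff q i)" "{..degree q}"]
        weight_semigroup_multiple[OF wS] by (fastforce simp: coordinate_ring_def split: if_splits)
    moreover have "eval_at x ?f = f (x w)" if "x \<in> power_line F" for x :: "int^'n \<Rightarrow> 'k"
    proof -
      have "x \<in> toric_points \<sigma>" using that power_point_closed[OF F] by (auto simp: power_line_def)
      then show ?thesis
        by (simp add: eval_at_sum q poly_altdef toric_points_multiple wS)
    qed
    ultimately show "restrict (f \<circ> (\<lambda>x. x w)) (power_line F) \<in>
        (\<lambda>f. \<lambda>x\<in>power_line F. eval_at x f) ` coordinate_ring \<sigma>"
      by (intro image_eqI[of _ _ ?f]) (auto simp: fun_eq_iff)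
  qed auto
  moreover have "variety_morphism (affine_line :: ('k, 'k) variety) (subvariety \<sigma> (power_line F))
      (\<lambda>t. power_point t F)"
    unfolding variety_morphism_def subvariety_def affine_line_def fst_conv snd_conv
  proof (intro conjI ballI)
    fix f assume "f \<in> (\<lambda>f. \<lambda>x\<in>power_line F. eval_at x f :: 'k) ` coordinate_ring \<sigma>"
    then obtain g where "g \<in> coordinate_ring \<sigma>" "f = (\<lambda>x\<in>power_line F. eval_at x g)" by auto
    then have "restrict (f \<circ> (\<lambda>t. power_point t F)) UNIV = poly (restrict_to_line F g)"
      by (auto simp: fun_eq_iff eval_at_power_point power_line_def)
    then show "restrict (f \<circ> (\<lambda>t. power_point t F)) UNIV \<in> range poly" by simp
  qed (auto simp: power_line_def)
  ultimately show ?thesis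
    unfolding variety_isomorphic_def
    by (intro exI[of _ "\<lambda>x. x w"] exI[of _ "\<lambda>t. power_point t F"])
       (auto simp: subvariety_def affine_line_def power_line_def at_w)
qed

section \<open>Irreducible components and orbits\<close>

abbreviation idempotent_variety :: "(int^'n \<Rightarrow> 'k::field) topology" where
  "idempotent_variety \<equiv> subtopology (zariski \<sigma>) (idempotents X)"

lemma irreducible_components_are_lines:
  fixes C :: "(int^'n \<Rightarrow> 'k::field_char_0) set"
  assumes "polyhedral_cone \<sigma>" and "C \<in> irreducible_components idempotent_variety"
  obtains F where "idempotent_face F" "C = power_line F"
    "\<And>G. idempotent_face G \<Longrightarrow> C \<subseteq> power_line G \<Longrightarrow> power_line G = C"
proof -
  let ?L = "power_line ` {F. idempotent_face F} :: (int^'n \<Rightarrow> 'k) set set"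
  have sub: "power_line F \<subseteq> idempotents (X :: (int^'n \<Rightarrow> 'k) monoid)" if "idempotent_face F" for F
    using idempotents_eq_Union_lines that by blast
  have fin: "finite ?L"
    using finite_weight_faces[OF assms(1)]
    by (intro finite_imageI) (auto simp: idempotent_face_def elim: rev_finite_subset)
  have cover: "topspace idempotent_variety \<subseteq> \<Union>?L"
    using idempotents_eq_Union_lines[where 'k='k] by auto
  have closed: "closedin idempotent_variety A" if "A \<in> ?L" for A
    using that closedin_power_line sub by (auto intro!: closedin_subset_topspace)
  have irr: "irreducible_in idempotent_variety A" if "A \<in> ?L" for A
    using that irreducible_power_line sub by (auto simp: idempotent_face_def)
  have "C \<in> ?L" by (rule irreducible_component_in_cover(1)[OF assms(2) fin cover closed irr])
  moreover have "power_line G = C" if "idempotent_face G" "C \<subseteq> power_line G" for G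
    by (rule irreducible_component_in_cover(2)[OF assms(2) fin cover closed irr]) (use that in auto)
  ultimately show ?thesis using that by blast
qed

lemma irreducible_components_disjoint:
  fixes C D :: "(int^'n \<Rightarrow> 'k::field_char_0) set"
  assumes "polyhedral_cone \<sigma>" "C \<in> irreducible_components idempotent_variety"
    "D \<in> irreducible_components idempotent_variety" "x \<in> C" "x \<in> D"
  shows "C = D"
proof -
  obtain F where F: "idempotent_face F" "C = power_line F"
    "\<And>G. idempotent_face G \<Longrightarrow> C \<subseteq> power_line G \<Longrightarrow> power_line G = C"
    using irreducible_components_are_lines[OF assms(1,2)] by metis
  obtain G where G: "idempotent_face G" "D = power_line G"
    "\<And>F. idempotent_face F \<Longrightarrow> D \<subseteq> power_line F \<Longrightarrow> power_line F = D"
    using irreducible_components_are_lines[OF assms(1,3)] by metis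
  show ?thesis
    using power_lines_comparable[OF F(1) G(1), of x] assms(4,5) F G by metis
qed

lemma two_sided_orbitsE:
  assumes "Q \<in> two_sided_orbits X"
  obtains x where "Q = {g \<star> x \<star> inv\<^bsub>X\<^esub> h | g h. g \<in> Units X \<and> h \<in> Units X}"
  using assms unfolding two_sided_orbits_def orbits_def orbit_def
  by (auto simp: DirProd_def units_of_def X_simps)

lemma two_sided_orbitsI:
  "x \<in> toric_points \<sigma> \<Longrightarrow>
    {g \<star> x \<star> inv\<^bsub>X\<^esub> h | g h. g \<in> Units X \<and> h \<in> Units X} \<in> two_sided_orbits X"
  unfolding two_sided_orbits_def orbits_def orbit_def
  by (auto simp: DirProd_def units_of_def X_simps)

text \<open>
  At height 0 the product is pointwise, and invertible elements have no zeros there.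
\<close>
lemma same_orbit_same_base:
  assumes "Q \<in> two_sided_orbits X" "y \<in> Q" "z \<in> Q" "u \<in> S" "height u = 0"
  shows "y u = 0 \<longleftrightarrow> z u = 0"
proof -
  obtain x where Q: "Q = {g \<star> x \<star> inv\<^bsub>X\<^esub> h | g h. g \<in> Units X \<and> h \<in> Units X}"
    using two_sided_orbitsE[OF assms(1)] .
  have "y u = 0 \<longleftrightarrow> x u = 0" if y: "y \<in> Q" for y
  proof -
    obtain g h where "y = g \<star> x \<star> inv\<^bsub>X\<^esub> h" "g \<in> Units X" "h \<in> Units X"
      using y Q by auto
    moreover have "g u \<noteq> 0"
      by (rule Units_nonzero[OF \<open>g \<in> Units X\<close> assms(4,5)])
    moreover have "(inv\<^bsub>X\<^esub> h) u \<noteq> 0"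
      by (rule Units_nonzero[OF monoid.Units_inv_Units[OF monoid_X \<open>h \<in> Units X\<close>] assms(4,5)])
    ultimately show ?thesis
      by (simp add: star_apply_height_0[OF assms(4,5)])
  qed
  then show ?thesis using assms(2,3) by blast
qed

text \<open>
  The orbit of the point with \<open>t = 0\<close> contains the whole line, as left translations move along it if \<open>e\<^sub>1\<close> is a
  direction of \<open>F\<close>, and right translations do so if \<open>e\<^sub>2\<close> is.
\<close>
lemma power_line_subset_orbit:
  assumes F: "idempotent_face F"
  shows "\<exists>Q\<in>two_sided_orbits (X :: (int^'n \<Rightarrow> 'k::field) monoid). power_line F \<subseteq> Q"
proof
  have Fw: "weight_face \<sigma> F" using F by (simp add: idempotent_face_def)
  let ?x = "power_point 0 F :: int^'n \<Rightarrow> 'k"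
  let ?Q = "{g \<star> ?x \<star> inv\<^bsub>X\<^esub> h | g h. g \<in> Units X \<and> h \<in> Units X}"
  show "?Q \<in> two_sided_orbits X" by (rule two_sided_orbitsI[OF power_point_closed[OF Fw]])
  have one: "\<one>\<^bsub>X\<^esub> \<in> Units (X :: (int^'n \<Rightarrow> 'k) monoid)" "inv\<^bsub>X\<^esub> \<one>\<^bsub>X\<^esub> = (\<one>\<^bsub>X\<^esub> :: int^'n \<Rightarrow> 'k)"
    by (rule monoid.Units_one_closed[OF monoid_X], rule monoid.inv_one[OF monoid_X])
  have left: "g \<star> ?x \<in> ?Q" if "g \<in> Units X" for g
  proof -
    have "g \<star> ?x \<in> toric_points \<sigma>"
      using that star_closed power_point_closed[OF Fw] by (auto simp: Units_def X_simps)
    then have "g \<star> ?x = g \<star> ?x \<star> inv\<^bsub>X\<^esub> \<one>\<^bsub>X\<^esub>" using one(2) by (simp add: star_unit X_simps(3))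
    then show ?thesis using that one(1) by blast
  qed
  have right: "?x \<star> g \<in> ?Q" if "g \<in> Units X" for g
  proof -
    have "?x \<star> g = \<one>\<^bsub>X\<^esub> \<star> ?x \<star> inv\<^bsub>X\<^esub> (inv\<^bsub>X\<^esub> g)"
      using that by (simp add: X_simps(3) unit_star power_point_closed[OF Fw] monoid.Units_inv_inv[OF monoid_X])
    then show ?thesis using that one(1) monoid.Units_inv_Units[OF monoid_X] by blast
  qed
  show "power_line F \<subseteq> ?Q"
  proof
    fix x :: "int^'n \<Rightarrow> 'k" assume "x \<in> power_line F"
    then obtain t where t: "x = power_point t F" by (auto simp: power_line_def)
    consider "\<forall>u\<in>F. height u = 0" | "has_direction F e1" | "has_direction F e2"
      using F by (auto simp: idempotent_face_def)
    then show "x \<in> ?Q"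
    proof cases
      case 1
      then have "x = \<one>\<^bsub>X\<^esub> \<star> ?x"
        using flat_power_line[OF 1, of t] flat_power_line[OF 1, of "0 :: 'k"]
        by (simp add: t X_simps(3) unit_star power_point_closed[OF Fw])
      then show ?thesis using left[OF one(1)] by simp
    next
      case 2
      have "power_point t S \<star> ?x = x"
        unfolding t
        using power_point_translate_left[OF direction_shift_iff[OF Fw lowering1 2], of t 0] by simp
      with left[OF power_point_S_unit[of t]] show ?thesis by (simp only:)
    next
      case 3
      have "?x \<star> power_point t S = x"
        unfolding t
        using power_point_translate_right[OF direction_shift_iff[OF Fw lowering2 3], of 0 t] by simp
      with right[OF power_point_S_unit[of t]] show ?thesis by (simp only:)
    qed
  qed
qed

text \<open>
  The weights orthogonal to \<open>\<gamma>\<close> form a face \<open>F\<close> that contains a multiple \<open>w\<close> of the functional exposing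
  \<open>\<gamma>\<close>. As \<open>\<rho>\<close> is not a ray of \<open>\<gamma>\<close>, this functional is positive on \<open>p\<close>, so \<open>w\<close> has positive
  height and \<open>w + e\<close> is a weight for both roots; hence the roots in the group of \<open>F\<close> are those orthogonal to
  \<open>\<gamma>\<close>. The point added in the closure is the indicator of the weights orthogonal to
  \<open>\<gamma>\<close> and of height 0, that is, orthogonal to \<open>\<rho>\<close> as well.
\<close>
lemma closure_of_idempotents_in_orbit:
  assumes \<gamma>: "is_face \<gamma> \<sigma>" "\<not> is_ray \<rho> \<gamma>"
    and \<rho>: "is_ray \<rho> \<sigma>" "rat_vec p \<in> \<rho>" "p \<noteq> 0"
    and roots: "(rat_vec e1 \<in> perp \<gamma>) \<noteq> (rat_vec e2 \<in> perp \<gamma>)"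
  shows "zariski \<sigma> closure_of (idempotents X \<inter> torus_orbit \<sigma> \<gamma>) =
    (idempotents X \<inter> torus_orbit \<sigma> \<gamma>) \<union>
      {distinguished_point \<sigma> (cone_hull (\<gamma> \<union> \<rho>)) :: int^'n \<Rightarrow> 'k::field_char_0}"
proof -
  define F where "F = {u \<in> S. rat_vec u \<in> perp \<gamma>}"
  obtain u0 where u0: "u0 \<in> dual_cone \<sigma>" "\<gamma> = {v \<in> \<sigma>. scalar_product v u0 = 0}"
    using \<gamma>(1) unfolding is_face_def by blast
  have pos: "0 \<le> scalar_product v (rat_vec u)" if "u \<in> S" "v \<in> \<gamma>" for u v
    using that u0(2) by (auto simp: weight_semigroup_def dual_cone_def)
  have Fw: "weight_face \<sigma> F"
    unfolding weight_face_def
  proof (intro conjI ballI)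
    show "F \<subseteq> S" by (auto simp: F_def)
    show "0 \<in> F" by (simp add: F_def weight_semigroup_0) (simp add: perp_def rat_vec_def scalar_product_def)
    show "u + v \<in> F \<longleftrightarrow> u \<in> F \<and> v \<in> F" if "u \<in> S" "v \<in> S" for u v
    proof -
      have "scalar_product x (rat_vec (u + v)) = 0 \<longleftrightarrow>
          scalar_product x (rat_vec u) = 0 \<and> scalar_product x (rat_vec v) = 0" if "x \<in> \<gamma>" for x
        using pos[OF \<open>u \<in> S\<close> that] pos[OF \<open>v \<in> S\<close> that]
        by (simp add: rat_vec_add scalar_product_add_right add_nonneg_eq_0_iff)
      then show ?thesis using that by (auto simp: F_def perp_def weight_semigroup_add)
    qed
  qed
  have on_line: "\<exists>c. x = c *s rat_vec p" if "x \<in> \<rho>" for x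
  proof -
    have "rat_vec p \<noteq> 0" using \<rho>(3) by (auto simp: rat_vec_def vec_eq_iff)
    then show ?thesis using mem_one_dimensional_cone[of \<rho> "rat_vec p" x] \<rho>(1,2) that
      by (auto simp: is_ray_def)
  qed
  obtain N w where w: "0 < N" "rat_vec w = of_int N *s u0" using clear_denominators .
  have wF: "w \<in> F"
    using u0 w by (auto simp: F_def weight_semigroup_def dual_cone_def perp_def scalar_product_scale_right)
  have w_pos: "height w \<noteq> 0"
  proof
    assume "height w = 0"
    then have "scalar_product p w = 0"
      using pairing_nonneg[of w] wF by (auto simp: height_def F_def)
    then have "scalar_product (rat_vec p) u0 = 0"
      using w scalar_product_rat_vec[of p w] by (simp add: scalar_product_scale_right)
    then have "\<rho> \<subseteq> \<gamma>"
      using on_line \<rho>(1) u0(2) by (fastforce simp: is_ray_def is_face_def scalar_product_scale_left)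
    moreover obtain r where r: "r \<in> dual_cone \<sigma>" "\<rho> = {v \<in> \<sigma>. scalar_product v r = 0}"
      using \<rho>(1) unfolding is_ray_def is_face_def by blast
    ultimately have "\<rho> = {v \<in> \<gamma>. scalar_product v r = 0}" "r \<in> dual_cone \<gamma>"
      using u0(2) by (auto simp: dual_cone_def)
    then have "is_ray \<rho> \<gamma>" using \<rho>(1) unfolding is_ray_def is_face_def by blast
    then show False using \<gamma>(2) by blast
  qed
  have direction: "has_direction F e \<longleftrightarrow> rat_vec e \<in> perp \<gamma>" if e: "lowering \<sigma> p e" for e
  proof
    show "rat_vec e \<in> perp \<gamma>" if "has_direction F e"
      using that by (auto simp: has_direction_def F_def perp_def rat_vec_add scalar_product_add_right)
    show "has_direction F e" if "rat_vec e \<in> perp \<gamma>"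
    proof -
      have "w + e \<in> S" using shift_mem[OF e, of w 1] wF w_pos by (simp add: F_def)
      then have "w + e \<in> F"
        using that wF by (auto simp: F_def perp_def rat_vec_add scalar_product_add_right)
      then show ?thesis using wF unfolding has_direction_def by blast
    qed
  qed
  have F: "idempotent_face F"
    using roots Fw direction[OF lowering1] direction[OF lowering2] by (simp add: idempotent_face_def)
  let ?E = "idempotents X \<inter> torus_orbit \<sigma> \<gamma> :: (int^'n \<Rightarrow> 'k) set"
  have "?E = {x \<in> idempotents X. support \<sigma> x = F}"
    by (auto simp: torus_orbit_def support_def F_def idempotents_X)
  also have "\<dots> = (\<lambda>t. power_point t F) ` (- {0})"
    by (rule idempotents_with_support[OF F wF w_pos])
  finally have E: "?E = (\<lambda>t. power_point t F) ` (- {0})" .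
  have perp_\<rho>: "rat_vec u \<in> perp \<rho> \<longleftrightarrow> height u = 0" if "u \<in> S" for u
  proof -
    have "rat_vec u \<in> perp \<rho> \<longleftrightarrow> scalar_product (rat_vec p) (rat_vec u) = 0"
      using on_line \<rho>(2) by (fastforce simp: perp_def scalar_product_scale_left)
    then show ?thesis using pairing_nonneg[OF that] by (simp add: scalar_product_rat_vec height_def)
  qed
  have "perp (cone_hull (\<gamma> \<union> \<rho>)) = perp \<gamma> \<inter> perp \<rho>"
    unfolding perp_cone_hull by (auto simp: perp_def)
  then have "distinguished_point \<sigma> (cone_hull (\<gamma> \<union> \<rho>)) = (power_point 0 F :: int^'n \<Rightarrow> 'k)"
    by (auto simp: distinguished_point_def power_point_def F_def perp_\<rho> fun_eq_iff)
  moreover have "power_line F = insert (power_point 0 F) ((\<lambda>t. power_point t F :: int^'n \<Rightarrow> 'k) ` (- {0}))"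
    unfolding power_line_def by (auto simp: image_iff)
  ultimately show ?thesis
    unfolding E closure_of_punctured_line[OF F] by simp
qed

end

theorem proposition3:
  fixes \<sigma> \<rho> :: "(rat^'n) set" and p e1 e2 :: "int^'n"
    and X :: "(int^'n \<Rightarrow> 'k::{alg_closed_field, field_char_0}) monoid"
  assumes "polyhedral_cone \<sigma>" and "strongly_convex \<sigma>"
    and "is_ray \<rho> \<sigma>" and "primitive_vector p \<rho>"
    and "demazure_root \<sigma> p e1" and "demazure_root \<sigma> p e2"
    and "X = toric_monoid \<sigma> p e1 e2"
  shows
    "(\<forall>\<gamma>. is_face \<gamma> \<sigma> \<and> \<not> is_ray \<rho> \<gamma> \<and> (rat_vec e1 \<in> perp \<gamma>) \<noteq> (rat_vec e2 \<in> perp \<gamma>) \<longrightarrow>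
        zariski \<sigma> closure_of (idempotents X \<inter> torus_orbit \<sigma> \<gamma>) =
          (idempotents X \<inter> torus_orbit \<sigma> \<gamma>) \<union> {distinguished_point \<sigma> (cone_hull (\<gamma> \<union> \<rho>))}) \<and>
     (let components = irreducible_components (subtopology (zariski \<sigma>) (idempotents X)) in
        (\<forall>C\<in>components. \<forall>D\<in>components. C \<noteq> D \<longrightarrow> C \<inter> D = {}) \<and>
        (\<forall>C\<in>components. (\<exists>x. C = {x}) \<or> variety_isomorphic (subvariety \<sigma> C) affine_line) \<and>
        (\<forall>C\<in>components. \<exists>Q\<in>two_sided_orbits X. C \<subseteq> Q) \<and>
        (\<forall>Q\<in>two_sided_orbits X. \<forall>C\<in>components. \<forall>D\<in>components. C \<subseteq> Q \<and> D \<subseteq> Q \<longrightarrow> C = D))"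
proof -
  have p: "rat_vec p \<in> \<rho>" "p \<noteq> 0" "rat_vec p \<in> \<sigma>"
    using assms(3,4) by (auto simp: primitive_vector_def is_ray_def is_face_def)
  interpret lowering_pair \<sigma> p e1 e2
  proof
    show "0 \<le> scalar_product p u" if "u \<in> weight_semigroup \<sigma>" for u
    proof -
      have "0 \<le> scalar_product (rat_vec p) (rat_vec u)"
        using that p(3) by (simp add: weight_semigroup_def dual_cone_def)
      then show ?thesis by (simp add: scalar_product_rat_vec)
    qed
    show "lowering \<sigma> p e1" "lowering \<sigma> p e2"
      by (rule demazure_root_lowering[OF assms(1,2)], fact)+
  qed
  let ?comps = "irreducible_components (subtopology (zariski \<sigma>) (idempotents X))"
  have lines: "\<exists>F. idempotent_face F \<and> C = power_line F" if "C \<in> ?comps" for C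
    using irreducible_components_are_lines[OF assms(1), of C] that unfolding assms(7) by metis
  have disjoint: "C = D" if "C \<in> ?comps" "D \<in> ?comps" "x \<in> C" "x \<in> D" for C D x
    using irreducible_components_disjoint[OF assms(1)] that unfolding assms(7) by metis
  have shape: "(\<exists>x. C = {x}) \<or> variety_isomorphic (subvariety \<sigma> C) (affine_line :: ('k, 'k) variety)"
    if C: "C \<in> ?comps" for C
  proof -
    obtain F where F: "idempotent_face F" "C = power_line F" using lines[OF C] by blast
    obtain w where w: "w \<in> F" "(\<forall>u\<in>F. height u = 0) \<or> height w = 1"
      using idempotent_face_parameter[OF F(1)] .
    from w(2) show ?thesis
    proof
      assume "\<forall>u\<in>F. height u = 0"
      then show ?thesis using flat_power_line F(2) by blast
    next
      assume "height w = 1"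
      moreover have "weight_face \<sigma> F" using F(1) by (simp add: idempotent_face_def)
      ultimately have "variety_isomorphic (subvariety \<sigma> C) (affine_line :: ('k, 'k) variety)"
        unfolding F(2) using w(1) by (intro power_line_isomorphic_affine_line)
      then show ?thesis ..
    qed
  qed
  have unique: "C = D" if Q: "Q \<in> two_sided_orbits X" "C \<subseteq> Q" "D \<subseteq> Q" and C: "C \<in> ?comps" and D: "D \<in> ?comps"
    for Q C D
  proof -
    obtain F where F: "idempotent_face F" "C = power_line F" using lines[OF C] by blast
    obtain G where G: "idempotent_face G" "D = power_line G" using lines[OF D] by blast
    have mem: "power_point 0 F \<in> C" "power_point 0 G \<in> D"
      unfolding F(2) G(2) power_line_def by auto
    have "power_point 0 F u = (power_point 0 G u :: 'k)" if "u \<in> S" for u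
    proof (cases "height u = 0")
      case True
      have "power_point 0 F u = (0 :: 'k) \<longleftrightarrow> power_point 0 G u = (0 :: 'k)"
        using Q(1) subsetD[OF Q(2) mem(1)] subsetD[OF Q(3) mem(2)] that True
        unfolding assms(7) by (rule same_orbit_same_base)
      then show ?thesis
        using that True by (simp add: power_point_apply split: if_splits)
    qed (use that in \<open>simp add: power_point_apply\<close>)
    then have "power_point 0 F = (power_point 0 G :: int^'n \<Rightarrow> 'k)"
      using F(1) G(1) power_point_closed toric_points_eqI unfolding idempotent_face_def by metis
    then show ?thesis using disjoint[OF C D mem(1)] mem(2) by simp
  qed
  have orbit: "\<exists>Q\<in>two_sided_orbits X. C \<subseteq> Q" if "C \<in> ?comps" for C
    using lines[OF that] power_line_subset_orbit unfolding assms(7) by metis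
  have closure: "zariski \<sigma> closure_of (idempotents X \<inter> torus_orbit \<sigma> \<gamma>) =
      (idempotents X \<inter> torus_orbit \<sigma> \<gamma>) \<union> {distinguished_point \<sigma> (cone_hull (\<gamma> \<union> \<rho>))}"
    if "is_face \<gamma> \<sigma>" "\<not> is_ray \<rho> \<gamma>" "(rat_vec e1 \<in> perp \<gamma>) \<noteq> (rat_vec e2 \<in> perp \<gamma>)" for \<gamma>
    unfolding assms(7) by (rule closure_of_idempotents_in_orbit[OF that(1,2) assms(3) p(1,2) that(3)])
  show ?thesis
    unfolding Let_def
  proof (intro conjI allI ballI impI)
    show "C \<inter> D = {}" if "C \<in> ?comps" "D \<in> ?comps" "C \<noteq> D" for C D
      using disjoint[OF that(1,2)] that(3) by blast
    show "C = D" if "Q \<in> two_sided_orbits X" "C \<in> ?comps" "D \<in> ?comps" "C \<subseteq> Q \<and> D \<subseteq> Q" for Q C D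
      using unique that by (elim conjE)
  qed (rule closure shape orbit; (elim conjE)?; assumption)+
qed

end
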